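(* Let $(\mathcal{A},H,D)$ be a pre-spectral triple and let $(\mathcal{A}\otimes q,H\otimes\mathbb{C}^2,D_2)$ be its clone. Then: (i) $D_2$ is self-adjoint. (ii) For all $a\in\mathcal{A}$, the operator $a\otimes q$ maps $\mathrm{dom}(D_2)$ into $\mathrm{dom}(D_2)$, and the operator $[D_2,a\otimes q]:\mathrm{dom}(D_2)\to H\otimes\mathbb{C}^2$ has bounded extension equal to $\partial(a)\otimes q$. (iii) The clone $(\mathcal{A}\otimes q,H\otimes\mathbb{C}^2,D_2)$ is a spectral triple. (iv) Let $p>0$. If $(\mathcal{A},H,D)$ is $p$-dimensional then $(\mathcal{A}\otimes q,H\otimes\mathbb{C}^2,D_2)$ is $p$-dimensional. (v) If $(\mathcal{A},H,D)$ is even with grading $\gamma$, then $(\mathcal{A}\otimes q,H\otimes\mathbb{C}^2,D_2)$ is even with grading $\gamma\otimes 1$.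
   Context: Hilbert spaces are complex and separable. A pre-spectral triple $(\mathcal{A},H,D)$ consists of a Hilbert space $H$, a $*$-subalgebra $\mathcal{A}$ of the bounded operators on $H$ (not assumed unital), and a densely defined closed symmetric operator $D:\mathrm{dom}(D)\to H$ such that for all $a\in\mathcal{A}$: $a(\mathrm{dom}(D^* ))\subseteq\mathrm{dom}(D)$; the commutator $[D^*,a]:\mathrm{dom}(D^* )\to H$ has a bounded extension to $H$, denoted $\partial(a)$; and $a(1+D^*D)^{-1/2}$ is compact. It is called even if $H$ is equipped with a grading $\gamma$ (a self-adjoint unitary) commuting with $\mathcal{A}$ and anticommuting with $D$. If $D=D^*$, it is called a spectral triple. Write $|D|^2=D^*D$ and $|D^*|^2=DD^*$. $\mathcal{L}_{1,\infty}$ is the ideal of compact operators $T$ whose singular values satisfy $\mu(n,T)=O((n+1)^{-1})$. For $p>0$ a pre-spectral triple is $p$-dimensional if for all $a\in\mathcal{A}$ the operators $a(1+|D|^2)^{-p/2}$, $\partial(a)(1+|D|^2)^{-p/2}$, $a(1+|D^*|^2)^{-p/2}$, $\partial(a)(1+|D^*|^2)^{-p/2}$ all belong to $\mathcal{L}_{1,\infty}$. The clone of $(\mathcal{A},H,D)$ is the triple $(\mathcal{A}\otimes q,H\otimes\mathbb{C}^2,D_2)$ where $q=\frac12\begin{pmatrix} 1 & 1 \\ 1 & 1 \end{pmatrix}$, $\mathcal{A}\otimes q=\{a\otimes q: a\in\mathcal{A}\}$, and $D_2=\begin{pmatrix} 0 & D^* \\ D & 0 \end{pmatrix}$ with domain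 $\mathrm{dom}(D)\oplus\mathrm{dom}(D^* )$. *)

theory Defs
  imports "HOL-Analysis.Analysis" "HOL-Library.Landau_Symbols"
    "HOL-Computational_Algebra.Polynomial"
begin

section \<open>Separable complex Hilbert spaces\<close>

text \<open>The inner product is antilinear in the first and linear in the second argument.\<close>

class complex_hilbert_space = banach +
  fixes scaleC :: "complex \<Rightarrow> 'a \<Rightarrow> 'a"  (infixr \<open>*\<^sub>C\<close> 75)
    and cinner :: "'a \<Rightarrow> 'a \<Rightarrow> complex"
  assumes scaleC_add_right: "c *\<^sub>C (x + y) = c *\<^sub>C x + c *\<^sub>C y"
    and scaleC_add_left: "(c + d) *\<^sub>C x = c *\<^sub>C x + d *\<^sub>C x"
    and scaleC_scaleC: "c *\<^sub>C d *\<^sub>C x = (c * d) *\<^sub>C x"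
    and scaleC_of_real: "complex_of_real r *\<^sub>C x = r *\<^sub>R x"
    and cinner_commute: "cinner x y = cnj (cinner y x)"
    and cinner_add_right: "cinner x (y + z) = cinner x y + cinner x z"
    and cinner_scaleC_right: "cinner x (c *\<^sub>C y) = c * cinner x y"
    and cinner_self: "cinner x x = complex_of_real ((norm x)\<^sup>2)"

global_interpretation complex_vector: vector_space
    "scaleC :: complex \<Rightarrow> 'a \<Rightarrow> 'a::complex_hilbert_space"
  defines csubspace = complex_vector.subspace
    and cspan = complex_vector.span
proof
  show "1 *\<^sub>C x = x" for x :: 'a
    using scaleC_of_real[of 1 x] by simp
qed (simp_all add: scaleC_add_right scaleC_add_left scaleC_scaleC)

text \<open>The product type is the Hilbert space direct sum \<open>H \<oplus> K\<close>; the norm of the library's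
  product type is already the right one.\<close>

instantiation prod :: (complex_hilbert_space, complex_hilbert_space) complex_hilbert_space
begin

definition scaleC_prod :: "complex \<Rightarrow> 'a \<times> 'b \<Rightarrow> 'a \<times> 'b" where
  "scaleC_prod c u = (c *\<^sub>C fst u, c *\<^sub>C snd u)"

definition cinner_prod :: "'a \<times> 'b \<Rightarrow> 'a \<times> 'b \<Rightarrow> complex" where
  "cinner_prod u v = cinner (fst u) (fst v) + cinner (snd u) (snd v)"

instance
proof
  show "cinner x y = cnj (cinner y x)" for x y :: "'a \<times> 'b"
    unfolding cinner_prod_def
    by (metis cinner_commute complex_cnj_add)
  show "cinner x x = complex_of_real ((norm x)\<^sup>2)" for x :: "'a \<times> 'b"
    by (simp add: cinner_prod_def cinner_self norm_prod_def)
qed (simp_all add: scaleC_prod_def cinner_prod_def scaleC_add_right scaleC_add_left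
      scaleC_scaleC scaleC_of_real cinner_add_right cinner_scaleC_right algebra_simps prod_eq_iff)

end

class separable_complex_hilbert_space = complex_hilbert_space + second_countable_topology

instance prod :: (separable_complex_hilbert_space, separable_complex_hilbert_space)
  separable_complex_hilbert_space ..

section \<open>Bounded operators\<close>

definition bounded_clinear ::
    "('a::complex_hilbert_space \<Rightarrow> 'b::complex_hilbert_space) \<Rightarrow> bool" where
  "bounded_clinear T \<longleftrightarrow> bounded_linear T \<and> (\<forall>c x. T (c *\<^sub>C x) = c *\<^sub>C T x)"

definition cadjoint :: "('a::complex_hilbert_space \<Rightarrow> 'a) \<Rightarrow> ('a \<Rightarrow> 'a)" where
  "cadjoint T = (THE S. \<forall>x y. cinner (S x) y = cinner x (T y))"

definition star_subalgebra :: "('a::complex_hilbert_space \<Rightarrow> 'a) set \<Rightarrow> bool" where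
  "star_subalgebra A \<longleftrightarrow>
     (\<forall>a\<in>A. bounded_clinear a) \<and>
     (\<lambda>x. 0) \<in> A \<and>
     (\<forall>a\<in>A. \<forall>b\<in>A. (\<lambda>x. a x + b x) \<in> A) \<and>
     (\<forall>c. \<forall>a\<in>A. (\<lambda>x. c *\<^sub>C a x) \<in> A) \<and>
     (\<forall>a\<in>A. \<forall>b\<in>A. a \<circ> b \<in> A) \<and>
     (\<forall>a\<in>A. cadjoint a \<in> A)"

definition compact_operator :: "('a::complex_hilbert_space \<Rightarrow> 'a) \<Rightarrow> bool" where
  "compact_operator T \<longleftrightarrow> bounded_clinear T \<and> compact (closure (T ` cball 0 1))"

text \<open>The singular values as approximation numbers,
  \<open>\<mu>(n,T) = inf {\<parallel>T - R\<parallel> : rank R \<le> n}\<close>, starting with \<open>\<mu>(0,T) = \<parallel>T\<parallel>\<close>.\<close>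

definition singular_value :: "nat \<Rightarrow> ('a::complex_hilbert_space \<Rightarrow> 'a) \<Rightarrow> real" where
  "singular_value n T =
     Inf {onorm (\<lambda>x. T x - R x) | R. bounded_clinear R \<and>
            (\<exists>B. finite B \<and> card B \<le> n \<and> range R \<subseteq> cspan B)}"

definition weak_trace_ideal :: "('a::complex_hilbert_space \<Rightarrow> 'a) set"  (\<open>\<L>\<^sub>1\<^sub>\<infinity>\<close>) where
  "\<L>\<^sub>1\<^sub>\<infinity> = {T. compact_operator T \<and> (\<lambda>n. singular_value n T) \<in> O(\<lambda>n. 1 / (real n + 1))}"

text \<open>Continuous functional calculus of a positive bounded operator \<open>B\<close>, whose spectrum lies in
  \<open>[0, \<parallel>B\<parallel>]\<close>: \<open>f(B)\<close> is the norm limit of \<open>P\<^sub>n(B)\<close> for polynomials \<open>P\<^sub>n\<close> converging to \<open>f\<close>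
  uniformly on that interval.\<close>

definition poly_op :: "real poly \<Rightarrow> ('a::complex_hilbert_space \<Rightarrow> 'a) \<Rightarrow> ('a \<Rightarrow> 'a)" where
  "poly_op P B = (\<lambda>x. \<Sum>i\<le>degree P. coeff P i *\<^sub>R (B ^^ i) x)"

definition functional_calculus ::
    "(real \<Rightarrow> real) \<Rightarrow> ('a::complex_hilbert_space \<Rightarrow> 'a) \<Rightarrow> ('a \<Rightarrow> 'a)" where
  "functional_calculus f B = (THE T. bounded_clinear T \<and>
     (\<forall>P :: nat \<Rightarrow> real poly.
        uniform_limit {0..onorm B} (\<lambda>n. poly (P n)) f sequentially \<longrightarrow>
        (\<lambda>n. onorm (\<lambda>x. T x - poly_op (P n) B x)) \<longlonglongrightarrow> 0))"

section \<open>Unbounded operators\<close>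

text \<open>An operator \<open>D : dom(D) \<rightarrow> H\<close> is identified with its graph, so that \<open>dom(D)\<close> is
  \<^term>\<open>Domain D\<close> and equality of operators includes equality of domains.
  Composition is \<^term>\<open>D O E\<close>, which applies \<^term>\<open>D\<close> first.\<close>

definition linear_operator :: "('a::complex_hilbert_space \<times> 'a) set \<Rightarrow> bool" where
  "linear_operator D \<longleftrightarrow> single_valued D \<and> csubspace D"

definition densely_defined :: "('a::complex_hilbert_space \<times> 'a) set \<Rightarrow> bool" where
  "densely_defined D \<longleftrightarrow> closure (Domain D) = UNIV"

definition op_adjoint ::
    "('a::complex_hilbert_space \<times> 'a) set \<Rightarrow> ('a \<times> 'a) set"  (\<open>_\<^sup>\<star>\<close> [1000] 999) where
  "D\<^sup>\<star> = {(y, z). \<forall>(x, w)\<in>D. cinner y w = cinner z x}"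

definition symmetric_operator :: "('a::complex_hilbert_space \<times> 'a) set \<Rightarrow> bool" where
  "symmetric_operator D \<longleftrightarrow> D \<subseteq> D\<^sup>\<star>"

definition selfadjoint_operator :: "('a::complex_hilbert_space \<times> 'a) set \<Rightarrow> bool" where
  "selfadjoint_operator D \<longleftrightarrow> linear_operator D \<and> densely_defined D \<and> D\<^sup>\<star> = D"

text \<open>The commutator \<open>[D,a] = Da - aD\<close> on its natural domain \<open>{x \<in> dom(D). a x \<in> dom(D)}\<close>,
  which is \<open>dom(D)\<close> if \<open>a\<close> preserves \<open>dom(D)\<close>.\<close>

definition commutator ::
    "('a::complex_hilbert_space \<times> 'a) set \<Rightarrow> ('a \<Rightarrow> 'a) \<Rightarrow> ('a \<times> 'a) set" where
  "commutator D a = {(x, v - a u) | x u v. (x, u) \<in> D \<and> (a x, v) \<in> D}"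

definition bounded_extension ::
    "('a::complex_hilbert_space \<times> 'a) set \<Rightarrow> ('a \<Rightarrow> 'a) \<Rightarrow> bool" where
  "bounded_extension C T \<longleftrightarrow> bounded_clinear T \<and> (\<forall>(x, y)\<in>C. T x = y)"

text \<open>\<open>(1 + S)\<^sup>-\<^sup>s = ((1 + S)\<^sup>-\<^sup>1)\<^sup>s\<close> for \<open>s > 0\<close> and a positive self-adjoint operator \<open>S\<close>; the
  pair \<^term>\<open>(y, x - y)\<close> lies in the graph of \<open>S\<close> iff \<open>(1 + S) y = x\<close>.\<close>

definition inverse_one_plus ::
    "('a::complex_hilbert_space \<times> 'a) set \<Rightarrow> ('a \<Rightarrow> 'a)" where
  "inverse_one_plus S = (\<lambda>x. THE y. (y, x - y) \<in> S)"

definition one_plus_neg_power ::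
    "('a::complex_hilbert_space \<times> 'a) set \<Rightarrow> real \<Rightarrow> ('a \<Rightarrow> 'a)" where
  "one_plus_neg_power S s = functional_calculus (\<lambda>t. t powr s) (inverse_one_plus S)"

section \<open>Pre-spectral triples\<close>

text \<open>The Hilbert space of a triple \<open>(A, H, D)\<close> is the underlying type.
  In view of the order of composition, the next two operators are \<open>|D|\<^sup>2 = D\<^sup>*D\<close> and
  \<open>|D\<^sup>*|\<^sup>2 = DD\<^sup>*\<close>.\<close>

definition abs_square ::
    "('a::complex_hilbert_space \<times> 'a) set \<Rightarrow> ('a \<times> 'a) set" where
  "abs_square D = D O D\<^sup>\<star>"

definition abs_square_adjoint ::
    "('a::complex_hilbert_space \<times> 'a) set \<Rightarrow> ('a \<times> 'a) set" where
  "abs_square_adjoint D = D\<^sup>\<star> O D"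

definition pre_spectral_triple ::
    "('h::separable_complex_hilbert_space \<Rightarrow> 'h) set \<Rightarrow> ('h \<times> 'h) set \<Rightarrow> bool" where
  "pre_spectral_triple A D \<longleftrightarrow>
     star_subalgebra A \<and>
     linear_operator D \<and> densely_defined D \<and> closed D \<and> symmetric_operator D \<and>
     (\<forall>a\<in>A. a ` Domain (D\<^sup>\<star>) \<subseteq> Domain D \<and>
            (\<exists>T. bounded_extension (commutator (D\<^sup>\<star>) a) T) \<and>
            compact_operator (a \<circ> one_plus_neg_power (abs_square D) (1/2)))"

text \<open>The bounded operator \<open>\<partial>(a)\<close>, the extension of \<open>[D\<^sup>*, a]\<close>.\<close>

definition deriv_op ::
    "('h::separable_complex_hilbert_space \<times> 'h) set \<Rightarrow> ('h \<Rightarrow> 'h) \<Rightarrow> ('h \<Rightarrow> 'h)" where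
  "deriv_op D a = (THE T. bounded_extension (commutator (D\<^sup>\<star>) a) T)"

definition spectral_triple ::
    "('h::separable_complex_hilbert_space \<Rightarrow> 'h) set \<Rightarrow> ('h \<times> 'h) set \<Rightarrow> bool" where
  "spectral_triple A D \<longleftrightarrow> pre_spectral_triple A D \<and> D = D\<^sup>\<star>"

definition grading :: "('h::complex_hilbert_space \<Rightarrow> 'h) \<Rightarrow> bool" where
  "grading \<gamma> \<longleftrightarrow> bounded_clinear \<gamma> \<and> cadjoint \<gamma> = \<gamma> \<and>
     cadjoint \<gamma> \<circ> \<gamma> = id \<and> \<gamma> \<circ> cadjoint \<gamma> = id"

text \<open>Anticommuting with \<open>D\<close> means \<open>\<gamma>(dom(D)) \<subseteq> dom(D)\<close> and \<open>D\<gamma> = -\<gamma>D\<close> on \<open>dom(D)\<close>.\<close>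

definition even_pre_spectral_triple ::
    "('h::separable_complex_hilbert_space \<Rightarrow> 'h) set \<Rightarrow> ('h \<times> 'h) set \<Rightarrow> ('h \<Rightarrow> 'h) \<Rightarrow> bool" where
  "even_pre_spectral_triple A D \<gamma> \<longleftrightarrow>
     pre_spectral_triple A D \<and> grading \<gamma> \<and>
     (\<forall>a\<in>A. \<gamma> \<circ> a = a \<circ> \<gamma>) \<and>
     (\<forall>(x, y)\<in>D. (\<gamma> x, - \<gamma> y) \<in> D)"

definition p_dimensional ::
    "real \<Rightarrow> ('h::separable_complex_hilbert_space \<Rightarrow> 'h) set \<Rightarrow> ('h \<times> 'h) set \<Rightarrow> bool" where
  "p_dimensional p A D \<longleftrightarrow>
     pre_spectral_triple A D \<and>
     (\<forall>a\<in>A.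
        a \<circ> one_plus_neg_power (abs_square D) (p/2) \<in> \<L>\<^sub>1\<^sub>\<infinity> \<and>
        deriv_op D a \<circ> one_plus_neg_power (abs_square D) (p/2) \<in> \<L>\<^sub>1\<^sub>\<infinity> \<and>
        a \<circ> one_plus_neg_power (abs_square_adjoint D) (p/2) \<in> \<L>\<^sub>1\<^sub>\<infinity> \<and>
        deriv_op D a \<circ> one_plus_neg_power (abs_square_adjoint D) (p/2) \<in> \<L>\<^sub>1\<^sub>\<infinity>)"

section \<open>The clone\<close>

text \<open>\<open>H \<otimes> \<complex>\<^sup>2\<close> is \<open>H \<oplus> H\<close>, on which \<open>a \<otimes> M\<close> acts as the block matrix \<open>(M\<^sub>i\<^sub>j a)\<close>.\<close>

definition tensor_matrix ::
    "('h::complex_hilbert_space \<Rightarrow> 'h) \<Rightarrow> complex^2^2 \<Rightarrow> ('h \<times> 'h \<Rightarrow> 'h \<times> 'h)"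
    (infixr \<open>\<otimes>\<^sub>2\<close> 75) where
  "a \<otimes>\<^sub>2 M = (\<lambda>(x, y). ((M $ 1 $ 1) *\<^sub>C a x + (M $ 1 $ 2) *\<^sub>C a y,
                         (M $ 2 $ 1) *\<^sub>C a x + (M $ 2 $ 2) *\<^sub>C a y))"

definition clone_q :: "complex^2^2" where
  "clone_q = vector [vector [1/2, 1/2], vector [1/2, 1/2]]"

definition clone_algebra ::
    "('h::complex_hilbert_space \<Rightarrow> 'h) set \<Rightarrow> ('h \<times> 'h \<Rightarrow> 'h \<times> 'h) set" where
  "clone_algebra A = {a \<otimes>\<^sub>2 clone_q | a. a \<in> A}"

definition clone_operator ::
    "('h::complex_hilbert_space \<times> 'h) set \<Rightarrow> (('h \<times> 'h) \<times> ('h \<times> 'h)) set" where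
  "clone_operator D = {((x, y), (v, w)) | x y v w. (y, v) \<in> D\<^sup>\<star> \<and> (x, w) \<in> D}"

end

theory Submission
  imports Defs "HOL-Computational_Algebra.Fundamental_Theorem_Algebra"
begin

text \<open>Write \<open>D\<^sub>2\<close> for the operator of the clone.

  \<^bold>\<open>Self-adjointness.\<close>  Pairing with vectors that have one zero component shows that the adjoint of
  \<open>D\<^sub>2\<close> has the off-diagonal entries \<open>D\<^sup>*\<close> and \<open>D\<^sup>*\<^sup>*\<close>.  Since \<open>D\<close> is closed, \<open>D\<^sup>*\<^sup>* = D\<close>, so this adjoint
  is \<open>D\<^sub>2\<close> itself (\<open>op_adjoint_clone_operator\<close>).

  \<^bold>\<open>Commutators.\<close>  The operator \<open>a \<otimes> q\<close> sends \<open>(x, y)\<close> to \<open>(a m, a m)\<close> with \<open>m = (x + y)/2\<close>.  For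
  \<open>x\<close> in \<open>dom(D)\<close> and \<open>y\<close> in \<open>dom(D\<^sup>*)\<close> the vector \<open>m\<close> lies in \<open>dom(D\<^sup>*)\<close>, hence \<open>a m\<close> in \<open>dom(D)\<close>, where \<open>D\<close>
  and \<open>D\<^sup>*\<close> agree.  So both components of the commutator are \<open>[D\<^sup>*, a] m\<close>
  (\<open>bounded_extension_clone_commutator\<close>).

  \<^bold>\<open>Functions of \<open>D\<^sub>2\<^sup>2\<close>.\<close>  The square of \<open>D\<^sub>2\<close> is diagonal with blocks \<open>D\<^sup>*D\<close> and \<open>DD\<^sup>*\<close>, so its
  powers \<open>(1 + D\<^sub>2\<^sup>2)\<^sup>-\<^sup>s\<close> are diagonal too (\<open>one_plus_neg_power_clone_operator\<close>).  That these powers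
  exist rests on two facts.  Projecting \<open>(x, 0)\<close> orthogonally onto the graph of a closed operator
  \<open>D\<close> solves \<open>(1 + D\<^sup>*D) y = x\<close>, and the solution operator is positive.  For a positive operator \<open>B\<close>
  one has \<open>\<parallel>P(B)\<parallel> \<le> sup |P|\<close> over \<open>[0, \<parallel>B\<parallel>]\<close> (\<open>onorm_poly_op_le\<close>), which makes the continuous
  functional calculus well defined.

  \<^bold>\<open>Compactness and summability.\<close>  Composing \<open>a \<otimes> q\<close> with a diagonal operator with blocks
  \<open>B\<close> and \<open>C\<close> gives a block operator with entries \<open>a B / 2\<close> and \<open>a C / 2\<close>.  It is compact if \<open>a B\<close> and \<open>a C\<close>
  are, and its singular value with index \<open>2n\<close> is at most \<open>\<mu>(n, a B) + \<mu>(n, a C)\<close>, so the decay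
  \<open>O(1/(n+1))\<close> is inherited.  The hypotheses speak of \<open>a (1 + D\<^sup>*D)\<^sup>-\<^sup>1\<^sup>/\<^sup>2\<close> only; that
  \<open>a (1 + DD\<^sup>*)\<^sup>-\<^sup>1\<^sup>/\<^sup>2\<close> is compact as well is the main analytic point
  (\<open>compact_operator_inverse_sqrt_adjoint\<close>).  It follows because \<open>a\<close> carries \<open>dom(D\<^sup>*)\<close> boundedly
  into \<open>dom(D)\<close> with the graph norm, where \<open>a\<^sup>*\<close> is compact.\<close>

section \<open>Geometry of complex Hilbert spaces\<close>

lemma cinner_add_left: "cinner (x + y) z = cinner x z + cinner y z"
  by (metis cinner_add_right cinner_commute complex_cnj_add)

lemma cinner_scaleC_left: "cinner (c *\<^sub>C x) y = cnj c * cinner x y"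
  by (metis cinner_commute cinner_scaleC_right complex_cnj_mult)

lemma cinner_self_Re: "Re (cinner x x) = (norm x)\<^sup>2"
  by (simp add: cinner_self)

lemma Re_cinner_commute: "Re (cinner y x) = Re (cinner x y)"
  by (subst cinner_commute) simp

lemma norm_scaleC: "norm (c *\<^sub>C x) = cmod c * norm x"
proof -
  have "complex_of_real ((norm (c *\<^sub>C x))\<^sup>2) = cnj c * (c * complex_of_real ((norm x)\<^sup>2))"
    by (simp only: cinner_self[symmetric] cinner_scaleC_left cinner_scaleC_right mult_ac)
  also have "\<dots> = complex_of_real ((cmod c * norm x)\<^sup>2)"
    by (simp add: power_mult_distrib complex_norm_square mult_ac del: of_real_power)
  finally have "(norm (c *\<^sub>C x))\<^sup>2 = (cmod c * norm x)\<^sup>2" by (metis of_real_eq_iff)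
  then show ?thesis by simp
qed

lemma norm_add_square: "(norm (x + y))\<^sup>2 = (norm x)\<^sup>2 + 2 * Re (cinner x y) + (norm y)\<^sup>2"
  using Re_cinner_commute[of x y]
  by (simp add: cinner_self_Re[symmetric] cinner_add_left cinner_add_right)

lemma norm_cinner_le: "cmod (cinner x y) \<le> norm x * norm y"
proof (cases "x = 0")
  case True
  have "cinner 0 y = cnj 0 * cinner 0 y"
    by (metis cinner_scaleC_left complex_vector.scale_zero_left)
  then show ?thesis using True by simp
next
  case False
  define t where "t = cinner x y"
  define c where "c = - t / complex_of_real ((norm x)\<^sup>2)"
  \<comment> \<open>With this \<open>c\<close>, \<open>y + c x\<close> is the component of \<open>y\<close> orthogonal to \<open>x\<close>.\<close>
  have "0 \<le> (norm (c *\<^sub>C x + y))\<^sup>2" by simp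
  also have "\<dots> = (cmod c * norm x)\<^sup>2 + 2 * Re (cnj c * t) + (norm y)\<^sup>2"
    by (simp add: norm_add_square norm_scaleC cinner_scaleC_left t_def)
  also have "cnj c * t = complex_of_real (- ((cmod t)\<^sup>2 / (norm x)\<^sup>2))"
    by (simp add: c_def complex_norm_square mult.commute del: of_real_power)
  also have "(cmod c * norm x)\<^sup>2 = (cmod t)\<^sup>2 / (norm x)\<^sup>2"
    using False by (simp add: c_def norm_divide norm_mult norm_power power_mult_distrib power_divide power2_eq_square)
  finally have "(cmod t)\<^sup>2 \<le> (norm x * norm y)\<^sup>2"
    using False by (simp add: field_simps power_mult_distrib)
  then show ?thesis by (simp add: power2_le_iff_abs_le t_def)
qed

lemma cinner_bounded_bilinear: "bounded_bilinear (cinner :: 'a::complex_hilbert_space \<Rightarrow> 'a \<Rightarrow> complex)"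
proof
  show "\<exists>K. \<forall>x y :: 'a. cmod (cinner x y) \<le> norm x * norm y * K"
    by (intro exI[of _ 1]) (simp add: norm_cinner_le)
qed (simp_all add: cinner_add_left cinner_add_right cinner_scaleC_left cinner_scaleC_right
    scaleR_conv_of_real flip: scaleC_of_real)

global_interpretation cinner: bounded_bilinear
  "cinner :: 'a::complex_hilbert_space \<Rightarrow> 'a \<Rightarrow> complex"
  by (rule cinner_bounded_bilinear)

lemma bounded_linear_scaleC: "bounded_linear (\<lambda>x. c *\<^sub>C x)"
  by (rule bounded_linear_intro[where K="cmod c"])
    (auto simp: scaleC_add_right norm_scaleC scaleC_scaleC mult.commute simp flip: scaleC_of_real)

lemma norm_diff_square: "(norm (x - y))\<^sup>2 = (norm x)\<^sup>2 - 2 * Re (cinner x y) + (norm y)\<^sup>2"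
  using norm_add_square[of x "- y"] by (simp add: cinner.minus_right)

lemma cinner_ext:
  assumes "\<And>z. cinner z x = cinner z y" shows "x = y"
proof -
  have "cinner (x - y) (x - y) = 0" using assms by (simp add: cinner.diff_right)
  then show ?thesis by (simp add: cinner_self)
qed

text \<open>By the parallelogram law a sequence in \<open>M\<close> whose distances to \<open>x\<close> tend to the infimum is a
  Cauchy sequence.  Its limit \<open>y\<close> is nearest to \<open>x\<close>, and if \<open>x - y\<close> were not orthogonal to some
  \<open>z\<close> in \<open>M\<close>, then moving \<open>y\<close> along \<open>z\<close> would bring it closer.\<close>

lemma closed_csubspace_projection:
  fixes M :: "'a::complex_hilbert_space set"
  assumes sub: "csubspace M" and cl: "closed M"
  obtains y where "y \<in> M" "\<And>m. m \<in> M \<Longrightarrow> cinner m (x - y) = 0"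
proof -
  define d where "d = Inf ((\<lambda>m. (norm (x - m))\<^sup>2) ` M)"
  have ne: "M \<noteq> {}" using complex_vector.subspace_0[OF sub] by auto
  have bdd: "bdd_below ((\<lambda>m. (norm (x - m))\<^sup>2) ` M)" by (rule bdd_belowI[of _ 0]) auto
  have d_le: "d \<le> (norm (x - m))\<^sup>2" if "m \<in> M" for m
    unfolding d_def using bdd that by (rule cINF_lower)
  have "\<exists>m\<in>M. (norm (x - m))\<^sup>2 < d + 1 / (real n + 1)" for n
  proof -
    have "Inf ((\<lambda>m. (norm (x - m))\<^sup>2) ` M) < d + 1 / (real n + 1)" by (simp add: d_def)
    then show ?thesis using cInf_less_iff[OF _ bdd] ne by auto
  qed
  then obtain m where m: "\<And>n. m n \<in> M" and m_lt: "\<And>n. (norm (x - m n))\<^sup>2 < d + 1 / (real n + 1)"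
    by metis
  have half: "(1/2) *\<^sub>R (m i + m j) \<in> M" for i j
    using complex_vector.subspace_scale[OF sub complex_vector.subspace_add[OF sub m m], of "complex_of_real (1/2)"]
    by (metis scaleC_of_real)
  have dist: "(norm (m i - m j))\<^sup>2 \<le> 2 / (real i + 1) + 2 / (real j + 1)" for i j
  proof -
    let ?u = "x - m i" and ?v = "x - m j"
    have "(norm (?u - ?v))\<^sup>2 + (norm (?u + ?v))\<^sup>2 = 2 * (norm ?u)\<^sup>2 + 2 * (norm ?v)\<^sup>2"
      unfolding norm_add_square norm_diff_square by simp
    moreover have "?u + ?v = 2 *\<^sub>R (x - (1/2) *\<^sub>R (m i + m j))" by (simp add: algebra_simps scaleR_2)
    then have "(norm (?u + ?v))\<^sup>2 \<ge> 4 * d" using d_le[OF half[of i j]] by (simp add: power_mult_distrib)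
    moreover have "norm (?u - ?v) = norm (m i - m j)" by (simp add: norm_minus_commute)
    moreover have "2 / (real k + 1) = 2 * (1 / (real k + 1))" for k by simp
    ultimately show ?thesis using m_lt[of i] m_lt[of j] by (smt (verit))
  qed
  have "Cauchy m"
  proof (rule metric_CauchyI)
    fix e :: real assume e: "e > 0"
    obtain N where N: "4 / e\<^sup>2 < real N" using reals_Archimedean2 by blast
    have "dist (m i) (m j) < e" if "i \<ge> N" "j \<ge> N" for i j
    proof -
      have "2 / (real i + 1) + 2 / (real j + 1) \<le> 2 / (real N + 1) + 2 / (real N + 1)"
        using that by (intro add_mono divide_left_mono) auto
      also have "\<dots> = 4 / (real N + 1)" by (simp flip: add_divide_distrib)
      also have "\<dots> < e\<^sup>2" using N e by (simp add: field_simps) (smt (verit) zero_less_power)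
      finally have "(norm (m i - m j))\<^sup>2 < e\<^sup>2" using dist[of i j] by linarith
      then show ?thesis using e by (simp add: dist_norm power2_less_imp_less)
    qed
    then show "\<exists>N. \<forall>i\<ge>N. \<forall>j\<ge>N. dist (m i) (m j) < e" by blast
  qed
  then obtain y where y: "m \<longlonglongrightarrow> y" using Cauchy_convergent convergent_def by blast
  have yM: "y \<in> M" using closed_sequentially[OF cl] m y by blast
  have "(\<lambda>n. d + 1 / (real n + 1)) \<longlonglongrightarrow> d + 0"
    by (intro tendsto_intros) (use LIMSEQ_inverse_real_of_nat in \<open>simp add: inverse_eq_divide add.commute\<close>)
  moreover have "(\<lambda>n. (norm (x - m n))\<^sup>2) \<longlonglongrightarrow> (norm (x - y))\<^sup>2" by (intro tendsto_intros y)
  ultimately have yd: "(norm (x - y))\<^sup>2 \<le> d"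
    using m_lt by (metis (no_types, lifting) LIMSEQ_le add.right_neutral less_imp_le)
  have "cinner z (x - y) = 0" if z: "z \<in> M" for z
  proof (cases "z = 0")
    case False
    define t where "t = cinner z (x - y)"
    define c where "c = t / complex_of_real ((norm z)\<^sup>2)"
    have "y + c *\<^sub>C z \<in> M" using sub yM z by (simp add: complex_vector.subspace_add complex_vector.subspace_scale)
    then have "(norm (x - y))\<^sup>2 \<le> (norm ((x - y) - c *\<^sub>C z))\<^sup>2"
      using yd d_le by (metis diff_diff_eq order_trans)
    also have "\<dots> = (norm (x - y))\<^sup>2 - 2 * Re (cnj c * t) + (cmod c * norm z)\<^sup>2"
      by (simp add: norm_diff_square norm_scaleC cinner_scaleC_left t_def Re_cinner_commute[of "x - y"])
    also have "cnj c * t = complex_of_real ((cmod t)\<^sup>2 / (norm z)\<^sup>2)"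
      by (simp add: c_def complex_norm_square mult.commute del: of_real_power)
    also have "(cmod c * norm z)\<^sup>2 = (cmod t)\<^sup>2 / (norm z)\<^sup>2"
      using False by (simp add: c_def norm_divide norm_mult norm_power power_mult_distrib power_divide power2_eq_square)
    finally have "(cmod t)\<^sup>2 / (norm z)\<^sup>2 \<le> 0" by simp
    then show ?thesis using False by (simp add: t_def divide_le_0_iff)
  qed (simp add: cinner.zero_left)
  then show thesis using that yM by blast
qed

text \<open>The kernel of \<open>f\<close> has codimension at most one, so \<open>f\<close> is a multiple of the inner product with a
  vector \<open>e\<close> orthogonal to the kernel.\<close>

lemma riesz_representation:
  fixes f :: "'a::complex_hilbert_space \<Rightarrow> complex"
  assumes f: "bounded_linear f" and scale: "\<And>c x. f (c *\<^sub>C x) = c * f x"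
  obtains z where "\<And>y. f y = cinner z y"
proof (cases "\<exists>u. f u \<noteq> 0")
  case True
  interpret f: bounded_linear f by (rule f)
  obtain u where u: "f u \<noteq> 0" using True by blast
  have "csubspace {x. f x = 0}"
    by (rule complex_vector.subspaceI) (auto simp: f.add f.zero scale)
  moreover have "closed {x. f x = 0}"
    by (intro closed_Collect_eq continuous_intros f.continuous_on)
  ultimately obtain p where p: "f p = 0" and orth: "\<And>m. f m = 0 \<Longrightarrow> cinner m (u - p) = 0"
    using closed_csubspace_projection[of "{x. f x = 0}" u] by auto
  define e where "e = u - p"
  have fe: "f e \<noteq> 0" using u p by (simp add: e_def f.diff)
  then have "e \<noteq> 0" using f.zero by auto
  then have nz: "complex_of_real ((norm e)\<^sup>2) \<noteq> 0" by simp
  have "f y = cinner ((cnj (f e) / complex_of_real ((norm e)\<^sup>2)) *\<^sub>C e) y" for y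
  proof -
    define m where "m = y - (f y / f e) *\<^sub>C e"
    have "f m = 0" using fe by (simp add: m_def f.diff scale)
    then have "cinner m e = 0" using orth by (simp add: e_def)
    then have "cinner e m = 0" by (metis cinner_commute complex_cnj_zero)
    then have "cinner e y = (f y / f e) * complex_of_real ((norm e)\<^sup>2)"
      by (simp add: m_def cinner.diff_right cinner_scaleC_right cinner_self)
    then show ?thesis using fe nz by (simp add: cinner_scaleC_left)
  qed
  then show thesis by (rule that)
next
  case False
  then show thesis using that[of 0] by (simp add: cinner.zero_left)
qed

section \<open>Bounded operators and their adjoints\<close>

lemma bounded_clinear_bounded_linear: "bounded_clinear T \<Longrightarrow> bounded_linear T"
  by (simp add: bounded_clinear_def)

lemma bounded_clinear_scaleC: "bounded_clinear T \<Longrightarrow> T (c *\<^sub>C x) = c *\<^sub>C T x"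
  by (simp add: bounded_clinear_def)

lemma bounded_clinear_zero: "bounded_clinear (\<lambda>x. 0)"
  by (simp add: bounded_clinear_def)

lemma bounded_clinear_add:
  "bounded_clinear S \<Longrightarrow> bounded_clinear T \<Longrightarrow> bounded_clinear (\<lambda>x. S x + T x)"
  by (simp add: bounded_clinear_def bounded_linear_add scaleC_add_right)

lemma bounded_clinear_sub:
  "bounded_clinear S \<Longrightarrow> bounded_clinear T \<Longrightarrow> bounded_clinear (\<lambda>x. S x - T x)"
  by (simp add: bounded_clinear_def bounded_linear_sub complex_vector.scale_right_diff_distrib)

lemma bounded_clinear_compose:
  "bounded_clinear S \<Longrightarrow> bounded_clinear T \<Longrightarrow> bounded_clinear (\<lambda>x. S (T x))"
  by (simp add: bounded_clinear_def bounded_linear_compose)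

lemma bounded_clinear_const_scaleC: "bounded_clinear (\<lambda>x. c *\<^sub>C x)"
  by (simp add: bounded_clinear_def bounded_linear_scaleC complex_vector.scale_left_commute)

lemma bounded_clinear_Pair:
  "bounded_clinear S \<Longrightarrow> bounded_clinear T \<Longrightarrow> bounded_clinear (\<lambda>x. (S x, T x))"
  by (simp add: bounded_clinear_def bounded_linear_Pair scaleC_prod_def)

lemma bounded_clinear_fst: "bounded_clinear fst"
  by (simp add: bounded_clinear_def bounded_linear_fst scaleC_prod_def)

lemma bounded_clinear_snd: "bounded_clinear snd"
  by (simp add: bounded_clinear_def bounded_linear_snd scaleC_prod_def)

lemma cadjoint_eqI:
  assumes "\<And>x y. cinner (S x) y = cinner x (T y)"
  shows "cadjoint T = S"
  unfolding cadjoint_def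
proof (rule the_equality)
  fix S' assume S': "\<forall>x y. cinner (S' x) y = cinner x (T y)"
  show "S' = S"
  proof
    fix x
    have "cinner y (S' x) = cinner y (S x)" for y
      using S' assms by (metis cinner_commute)
    then show "S' x = S x" by (rule cinner_ext)
  qed
qed (use assms in blast)

text \<open>The adjoint is specified by a definite description; the Riesz representation makes this
  description refer for every bounded operator.\<close>

lemma cinner_cadjoint:
  assumes T: "bounded_clinear T"
  shows "cinner (cadjoint T x) y = cinner x (T y)"
proof -
  have "\<exists>z. \<forall>y. cinner x (T y) = cinner z y" for x
  proof -
    have "bounded_linear (\<lambda>y. cinner x (T y))"
      using bounded_linear_compose[OF cinner.bounded_linear_right bounded_clinear_bounded_linear[OF T]] .
    then show ?thesis
      by (rule riesz_representation)
        (use T in \<open>auto simp: bounded_clinear_scaleC cinner_scaleC_right\<close>)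
  qed
  then obtain S where "\<And>x y. cinner x (T y) = cinner (S x) y" by metis
  then show ?thesis using cadjoint_eqI[of S T] by metis
qed

section \<open>Adjoints of unbounded operators\<close>

lemma op_adjoint_iff: "(y, z) \<in> D\<^sup>\<star> \<longleftrightarrow> (\<forall>x w. (x, w) \<in> D \<longrightarrow> cinner y w = cinner z x)"
  by (auto simp: op_adjoint_def)

lemma csubspace_op_adjoint: "csubspace (D\<^sup>\<star>)"
  by (rule complex_vector.subspaceI)
    (auto simp: op_adjoint_iff scaleC_prod_def zero_prod_def cinner.zero_left
        cinner_add_left cinner_scaleC_left)

lemma closed_op_adjoint: "closed (D\<^sup>\<star>)"
proof -
  have "D\<^sup>\<star> = (\<Inter>p\<in>D. {u. cinner (fst u) (snd p) = cinner (snd u) (fst p)})"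
    by (fastforce simp: op_adjoint_def)
  also have "closed \<dots>"
    by (intro closed_INT ballI closed_Collect_eq cinner.continuous_on continuous_intros)
  finally show ?thesis .
qed

lemma subset_op_adjoint_op_adjoint: "D \<subseteq> (D\<^sup>\<star>)\<^sup>\<star>"
  by (auto simp: op_adjoint_def) (metis (mono_tags, lifting) case_prodD cinner_commute)

text \<open>A vector of \<open>H \<oplus> H\<close> orthogonal to the graph of \<open>D\<close> is, up to the rotation
  \<open>(u, v) \<mapsto> (v, -u)\<close>, an element of the graph of \<open>D\<^sup>*\<close>.  So the projection theorem
  decomposes every vector along the two graphs.\<close>

lemma graph_decomposition:
  assumes "csubspace D" "closed D"
  obtains x y where "(x, y) \<in> D" "(v - y, x - u) \<in> D\<^sup>\<star>"
proof -
  obtain p where p: "p \<in> D" and orth: "\<And>m. m \<in> D \<Longrightarrow> cinner m ((u, v) - p) = 0"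
    using closed_csubspace_projection[OF assms] by blast
  have "(v - snd p, fst p - u) \<in> D\<^sup>\<star>"
    unfolding op_adjoint_iff
  proof (intro allI impI)
    fix x w assume "(x, w) \<in> D"
    then have "cinner x (u - fst p) + cinner w (v - snd p) = 0"
      using orth by (fastforce simp: cinner_prod_def)
    then have "cinner w (v - snd p) = cinner x (fst p - u)"
      by (simp add: cinner.diff_right add_eq_0_iff)
    then show "cinner (v - snd p) w = cinner (fst p - u) x" by (metis cinner_commute)
  qed
  then show thesis using that[of "fst p" "snd p"] p by simp
qed

text \<open>The part of an element of \<open>D\<^sup>*\<^sup>*\<close> orthogonal to the graph of \<open>D\<close> lies in \<open>D\<^sup>*\<^sup>*\<close> and, after
  rotation, in \<open>D\<^sup>*\<close>.  Pairing the two shows that its squared norm is zero.\<close>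

lemma op_adjoint_op_adjoint:
  assumes "csubspace D" "closed D"
  shows "(D\<^sup>\<star>)\<^sup>\<star> = D"
proof
  show "(D\<^sup>\<star>)\<^sup>\<star> \<subseteq> D"
  proof
    fix p assume p: "p \<in> (D\<^sup>\<star>)\<^sup>\<star>"
    obtain x y where xy: "(x, y) \<in> D" and ad: "(snd p - y, x - fst p) \<in> D\<^sup>\<star>"
      using graph_decomposition[OF assms] by blast
    have "p - (x, y) \<in> (D\<^sup>\<star>)\<^sup>\<star>"
      using p xy subset_op_adjoint_op_adjoint[of D]
      by (intro complex_vector.subspace_diff[OF csubspace_op_adjoint]) auto
    then have "(fst p - x, snd p - y) \<in> (D\<^sup>\<star>)\<^sup>\<star>" by (simp add: minus_prod_def)
    then have "cinner (fst p - x) (x - fst p) = cinner (snd p - y) (snd p - y)"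
      using ad op_adjoint_iff[of _ _ "D\<^sup>\<star>"] by blast
    moreover have "cinner (fst p - x) (x - fst p) = - cinner (fst p - x) (fst p - x)"
      by (metis cinner.minus_right minus_diff_eq)
    ultimately have "complex_of_real (- (norm (fst p - x))\<^sup>2) = complex_of_real ((norm (snd p - y))\<^sup>2)"
      by (simp add: cinner_self)
    then have "- (norm (fst p - x))\<^sup>2 = (norm (snd p - y))\<^sup>2" by (simp only: of_real_eq_iff)
    then have "norm (fst p - x) = 0" "norm (snd p - y) = 0"
      by (smt (verit) zero_le_power2 zero_less_power2 norm_eq_zero)+
    then show "p \<in> D" using xy by (simp add: prod_eq_iff) (metis prod.collapse)
  qed
qed (rule subset_op_adjoint_op_adjoint)

lemma single_valued_op_adjoint:
  assumes "densely_defined D"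
  shows "single_valued (D\<^sup>\<star>)"
proof (rule single_valuedI)
  fix y z z' assume z: "(y, z) \<in> D\<^sup>\<star>" "(y, z') \<in> D\<^sup>\<star>"
  have "cinner (z - z') x = 0" if "x \<in> closure (Domain D)" for x
  proof (rule continuous_constant_on_closure[where f = "cinner (z - z')", OF _ _ that])
    show "continuous_on (closure (Domain D)) (cinner (z - z'))"
      by (intro cinner.continuous_on continuous_intros)
  qed (use z in \<open>fastforce simp: op_adjoint_iff cinner.diff_left\<close>)
  then have "cinner (z - z') (z - z') = 0" using assms by (simp add: densely_defined_def)
  then show "z = z'" by (simp add: cinner_self)
qed

section \<open>Polynomials of a positive operator\<close>

text \<open>Complex coefficients are needed in order to factor a polynomial of an operator completely.\<close>

definition cpoly_op ::
    "complex poly \<Rightarrow> ('a::complex_hilbert_space \<Rightarrow> 'a) \<Rightarrow> ('a \<Rightarrow> 'a)" where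
  "cpoly_op p B = (\<lambda>x. \<Sum>i\<le>degree p. coeff p i *\<^sub>C (B ^^ i) x)"

abbreviation complex_poly :: "real poly \<Rightarrow> complex poly" where
  "complex_poly \<equiv> map_poly complex_of_real"

lemma complex_poly_mult: "complex_poly (p * q) = complex_poly p * complex_poly q"
  by (rule poly_eqI) (simp add: coeff_map_poly coeff_mult)

lemma complex_poly_diff: "complex_poly (p - q) = complex_poly p - complex_poly q"
  by (rule poly_eqI) (simp add: coeff_map_poly)

lemma poly_op_eq_cpoly_op: "poly_op P B = cpoly_op (complex_poly P) B"
proof -
  have "degree (complex_poly P) = degree P" by (rule degree_map_poly) simp
  then show ?thesis
    by (simp add: poly_op_def cpoly_op_def coeff_map_poly scaleC_of_real)
qed

lemma cpoly_op_eq_sum: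
  assumes "degree p \<le> n"
  shows "cpoly_op p B x = (\<Sum>i\<le>n. coeff p i *\<^sub>C (B ^^ i) x)"
  unfolding cpoly_op_def
  by (rule sum.mono_neutral_left) (use assms in \<open>auto simp: coeff_eq_0 not_le\<close>)

lemma cpoly_op_0: "cpoly_op 0 B x = 0"
  by (simp add: cpoly_op_def)

lemma cpoly_op_add: "cpoly_op (p + q) B x = cpoly_op p B x + cpoly_op q B x"
  by (simp add: cpoly_op_eq_sum[where n = "max (degree p) (degree q)"] degree_add_le_max
      scaleC_add_left sum.distrib)

lemma cpoly_op_diff: "cpoly_op (p - q) B x = cpoly_op p B x - cpoly_op q B x"
  using cpoly_op_add[of "p - q" q B x] by simp

lemma cpoly_op_smult: "cpoly_op (smult c p) B x = c *\<^sub>C cpoly_op p B x"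
  by (simp add: cpoly_op_eq_sum[where n = "degree p"] degree_smult_le
      complex_vector.scale_sum_right scaleC_scaleC)

lemma cpoly_op_pCons: "cpoly_op (pCons c p) B x = c *\<^sub>C x + cpoly_op p B (B x)"
proof -
  have "cpoly_op (pCons c p) B x = (\<Sum>i\<le>Suc (degree p). coeff (pCons c p) i *\<^sub>C (B ^^ i) x)"
    by (rule cpoly_op_eq_sum) (rule degree_pCons_le)
  also have "\<dots> = c *\<^sub>C x + cpoly_op p B (B x)"
    by (simp add: sum.atMost_Suc_shift cpoly_op_def funpow_swap1 del: sum.atMost_Suc)
  finally show ?thesis .
qed

lemma bounded_clinear_cpoly_op:
  assumes "bounded_clinear B" shows "bounded_clinear (cpoly_op p B)"
proof (induction p)
  case 0
  have "cpoly_op 0 B = (\<lambda>x. 0)" by (simp add: fun_eq_iff cpoly_op_0)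
  then show ?case by (simp add: bounded_clinear_zero)
next
  case (pCons c p)
  have "cpoly_op (pCons c p) B = (\<lambda>x. c *\<^sub>C x + cpoly_op p B (B x))"
    by (simp add: fun_eq_iff cpoly_op_pCons)
  then show ?case
    using bounded_clinear_add[OF bounded_clinear_const_scaleC bounded_clinear_compose[OF pCons.IH assms]]
    by simp
qed

lemma cpoly_op_mult:
  assumes B: "bounded_clinear B"
  shows "cpoly_op (p * q) B x = cpoly_op p B (cpoly_op q B x)"
proof (induction p arbitrary: x)
  case 0
  then show ?case by (simp add: cpoly_op_0)
next
  case (pCons c p)
  have commute: "cpoly_op q B (B x) = B (cpoly_op q B x)" for x
  proof (induction q arbitrary: x)
    case 0
    then show ?case
      by (simp add: cpoly_op_0 linear_simps(3)[OF bounded_clinear_bounded_linear[OF B]])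
  next
    case (pCons d q)
    then show ?case
      by (simp add: cpoly_op_pCons bounded_clinear_scaleC[OF B]
          linear_simps(1)[OF bounded_clinear_bounded_linear[OF B]])
  qed
  have "cpoly_op (pCons c p * q) B x = c *\<^sub>C cpoly_op q B x + cpoly_op p B (cpoly_op q B (B x))"
    by (simp add: cpoly_op_add cpoly_op_smult cpoly_op_pCons pCons.IH)
  then show ?case by (simp add: cpoly_op_pCons commute)
qed

lemma bounded_clinear_poly_op: "bounded_clinear B \<Longrightarrow> bounded_clinear (poly_op P B)"
  by (simp add: poly_op_eq_cpoly_op bounded_clinear_cpoly_op)

lemma poly_op_mult:
  "bounded_clinear B \<Longrightarrow> poly_op (P * Q) B x = poly_op P B (poly_op Q B x)"
  by (simp add: poly_op_eq_cpoly_op complex_poly_mult cpoly_op_mult)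

lemma poly_op_diff: "poly_op (P - Q) B x = poly_op P B x - poly_op Q B x"
  by (simp add: poly_op_eq_cpoly_op complex_poly_diff cpoly_op_diff)

lemma poly_op_const: "poly_op [:c:] B x = c *\<^sub>R x"
  by (simp add: poly_op_def)

definition positive_operator :: "('a::complex_hilbert_space \<Rightarrow> 'a) \<Rightarrow> bool" where
  "positive_operator B \<longleftrightarrow> bounded_clinear B \<and>
     (\<forall>x y. cinner (B x) y = cinner x (B y)) \<and> (\<forall>x. 0 \<le> Re (cinner x (B x)))"

lemma poly_op_selfadjoint:
  assumes "\<And>x y. cinner (B x) y = cinner x (B y)"
  shows "cinner (poly_op P B x) y = cinner x (poly_op P B y)"
proof -
  have "cinner ((B ^^ i) x) y = cinner x ((B ^^ i) y)" for i
    by (induction i arbitrary: x y) (simp_all add: assms funpow_swap1)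
  then show ?thesis
    by (simp add: poly_op_def cinner.sum_left cinner.sum_right cinner.scaleR_left cinner.scaleR_right)
qed

definition bounded_below :: "('a::real_normed_vector \<Rightarrow> 'b::real_normed_vector) \<Rightarrow> bool" where
  "bounded_below T \<longleftrightarrow> (\<exists>c>0. \<forall>x. c * norm x \<le> norm (T x))"

lemma bounded_belowI: "c > 0 \<Longrightarrow> (\<And>x. c * norm x \<le> norm (T x)) \<Longrightarrow> bounded_below T"
  by (auto simp: bounded_below_def)

lemma bounded_below_compose:
  assumes "bounded_below S" "bounded_below T" shows "bounded_below (\<lambda>x. S (T x))"
proof -
  obtain c d where c: "c > 0" "\<And>x. c * norm x \<le> norm (S x)" and d: "d > 0" "\<And>x. d * norm x \<le> norm (T x)"
    using assms by (auto simp: bounded_below_def)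
  show ?thesis
  proof (rule bounded_belowI[of "c * d"])
    fix x
    have "c * d * norm x \<le> c * norm (T x)" using c d by (simp add: mult.assoc)
    then show "c * d * norm x \<le> norm (S (T x))" using c(2) order_trans by blast
  qed (use c d in simp)
qed

text \<open>Factor the polynomial into linear factors over \<open>\<complex>\<close>: a product of operators that are
  bounded below is bounded below.\<close>

lemma not_bounded_below_imp_root:
  assumes B: "bounded_clinear B" and "p \<noteq> 0" "\<not> bounded_below (cpoly_op p B)"
  obtains z where "poly p z = 0" "\<not> bounded_below (\<lambda>x. B x - z *\<^sub>C x)"
  using assms(2,3)
proof (induction "degree p" arbitrary: p thesis)
  case 0
  then obtain c where p: "p = [:c:]" and c: "c \<noteq> 0"
    by (metis degree_eq_zeroE pCons_0_0)
  have "bounded_below (cpoly_op p B)"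
    by (rule bounded_belowI[of "cmod c"]) (use c in \<open>auto simp: p cpoly_op_pCons cpoly_op_0 norm_scaleC\<close>)
  then show ?case using 0 by blast
next
  case (Suc n)
  obtain z where z: "poly p z = 0"
    using fundamental_theorem_of_algebra_alt[of p] Suc.hyps(2) by fastforce
  then obtain q where p: "p = [:-z, 1:] * q" by (metis poly_eq_0_iff_dvd dvdE)
  have q: "q \<noteq> 0" using p Suc.prems(2) by auto
  have deg: "n = degree q" using Suc.hyps(2) q unfolding p by (simp add: degree_mult_eq del: mult_pCons_left)
  have eq: "cpoly_op p B = (\<lambda>x. B (cpoly_op q B x) - z *\<^sub>C cpoly_op q B x)"
    unfolding p cpoly_op_mult[OF B] fun_eq_iff
    by (simp add: cpoly_op_pCons cpoly_op_0 add.commute)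
  show ?case
  proof (cases "bounded_below (cpoly_op q B)")
    case True
    then have "\<not> bounded_below (\<lambda>x. B x - z *\<^sub>C x)"
      using bounded_below_compose[of "\<lambda>x. B x - z *\<^sub>C x" "cpoly_op q B"] Suc.prems(3) eq by auto
    then show ?thesis using Suc.prems(1) z by blast
  next
    case False
    then obtain w where "poly q w = 0" "\<not> bounded_below (\<lambda>x. B x - w *\<^sub>C x)"
      using Suc.hyps(1)[OF deg] q by blast
    then show ?thesis using Suc.prems(1)[of w] by (simp add: p)
  qed
qed

text \<open>For a unit vector \<open>x\<close> the number \<open>\<langle>x, B x\<rangle>\<close> lies in \<open>[0, \<parallel>B\<parallel>]\<close>, and \<open>\<parallel>B x - z x\<parallel>\<close> is at
  least its distance from \<open>z\<close>.\<close>

lemma not_bounded_below_imp_in_interval: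
  assumes pos: "positive_operator B" and nb: "\<not> bounded_below (\<lambda>x. B x - z *\<^sub>C x)"
  shows "z \<in> complex_of_real ` {0..onorm B}"
proof (rule ccontr)
  assume z: "z \<notin> complex_of_real ` {0..onorm B}"
  have B: "bounded_linear B" using pos by (simp add: positive_operator_def bounded_clinear_def)
  define \<delta> where "\<delta> = (if Im z \<noteq> 0 then \<bar>Im z\<bar> else max (- Re z) (Re z - onorm B))"
  have \<delta>: "\<delta> > 0"
  proof (cases "Im z = 0")
    case True
    then have "z = complex_of_real (Re z)" by (simp add: complex_eq_iff)
    then have "Re z \<notin> {0..onorm B}" using z by (metis imageI)
    then show ?thesis using True by (auto simp: \<delta>_def)
  qed (simp add: \<delta>_def)
  have "\<delta> * norm x \<le> norm (B x - z *\<^sub>C x)" for x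
  proof (cases "x = 0")
    case False
    define r where "r = Re (cinner x (B x))"
    have "cinner x (B x) = cnj (cinner x (B x))"
      using pos cinner_commute[of x "B x"] by (simp add: positive_operator_def)
    then have r: "cinner x (B x) = complex_of_real r"
      by (simp add: complex_eq_iff r_def)
    have r0: "r \<ge> 0" using pos by (simp add: positive_operator_def r_def)
    have "r \<le> cmod (cinner x (B x))" unfolding r_def by (rule complex_Re_le_cmod)
    also have "\<dots> \<le> norm x * (onorm B * norm x)"
      using norm_cinner_le[of x "B x"] onorm[OF B, of x] by (meson mult_left_mono norm_ge_zero order_trans)
    finally have r1: "r \<le> onorm B * (norm x)\<^sup>2" by (simp add: power2_eq_square mult_ac)
    define w where "w = complex_of_real r - z * complex_of_real ((norm x)\<^sup>2)"
    have w: "Re w = r - Re z * (norm x)\<^sup>2" "Im w = - Im z * (norm x)\<^sup>2"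
      by (simp_all add: w_def del: of_real_power)
    have "\<delta> * (norm x)\<^sup>2 \<le> cmod w"
    proof (cases "Im z = 0")
      case False
      then show ?thesis using abs_Im_le_cmod[of w] by (simp add: \<delta>_def w abs_mult)
    next
      case True
      have "- Re z * (norm x)\<^sup>2 \<le> Re w" "(Re z - onorm B) * (norm x)\<^sup>2 \<le> - Re w"
        using r0 r1 by (simp_all add: w algebra_simps)
      then have "\<delta> * (norm x)\<^sup>2 \<le> \<bar>Re w\<bar>"
        using True by (auto simp: \<delta>_def max_def)
      then show ?thesis using abs_Re_le_cmod[of w] by linarith
    qed
    also have "w = cinner x (B x - z *\<^sub>C x)"
      by (simp add: w_def cinner.diff_right r cinner_scaleC_right cinner_self)
    also have "cmod \<dots> \<le> norm x * norm (B x - z *\<^sub>C x)" by (rule norm_cinner_le)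
    finally have "norm x * (\<delta> * norm x) \<le> norm x * norm (B x - z *\<^sub>C x)"
      by (simp add: power2_eq_square mult_ac)
    then show ?thesis using False by simp
  qed simp
  then show False using nb bounded_belowI[OF \<delta>, of "\<lambda>x. B x - z *\<^sub>C x"] by simp
qed

text \<open>For self-adjoint \<open>C\<close> of norm \<open>N\<close> one has
  \<open>\<parallel>C\<^sup>2x - N\<^sup>2x\<parallel>\<^sup>2 \<le> N\<^sup>2 (N\<^sup>2 \<parallel>x\<parallel>\<^sup>2 - \<parallel>C x\<parallel>\<^sup>2)\<close>, which is small if \<open>x\<close> nearly attains the norm.\<close>

lemma not_bounded_below_square_minus_onorm:
  assumes C: "bounded_linear C" and sa: "\<And>x y. cinner (C x) y = cinner x (C y)"
    and N: "onorm C > 0"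
  shows "\<not> bounded_below (\<lambda>x. C (C x) - (onorm C)\<^sup>2 *\<^sub>R x)"
proof
  let ?N = "onorm C"
  assume "bounded_below (\<lambda>x. C (C x) - ?N\<^sup>2 *\<^sub>R x)"
  then obtain c where c: "c > 0" and below: "\<And>x. c * norm x \<le> norm (C (C x) - ?N\<^sup>2 *\<^sub>R x)"
    by (auto simp: bounded_below_def)
  define k where "k = max 0 (?N\<^sup>2 - c\<^sup>2 / ?N\<^sup>2)"
  have "norm (C x) \<le> sqrt k * norm x" for x
  proof -
    have "(c * norm x)\<^sup>2 \<le> (norm (C (C x) - ?N\<^sup>2 *\<^sub>R x))\<^sup>2"
      using below c by (intro power_mono) auto
    also have "\<dots> = (norm (C (C x)))\<^sup>2 - 2 * (?N\<^sup>2 * Re (cinner (C (C x)) x)) + ?N\<^sup>2 * ?N\<^sup>2 * (norm x)\<^sup>2"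
      by (simp add: norm_diff_square cinner.scaleR_right power_mult_distrib power2_eq_square[of "?N\<^sup>2"])
    also have "Re (cinner (C (C x)) x) = (norm (C x))\<^sup>2"
      by (simp only: sa[of "C x" x] cinner_self_Re)
    also have "(norm (C (C x)))\<^sup>2 \<le> (?N * norm (C x))\<^sup>2"
      using onorm[OF C] by (intro power_mono) auto
    finally have "?N\<^sup>2 * (norm (C x))\<^sup>2 \<le> (?N\<^sup>2 * ?N\<^sup>2 - c\<^sup>2) * (norm x)\<^sup>2"
      by (simp add: power_mult_distrib algebra_simps)
    then have "(norm (C x))\<^sup>2 \<le> (?N\<^sup>2 - c\<^sup>2 / ?N\<^sup>2) * (norm x)\<^sup>2"
      using N by (simp add: field_simps)
    also have "\<dots> \<le> k * (norm x)\<^sup>2" by (intro mult_right_mono) (auto simp: k_def)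
    also have "\<dots> = (sqrt k * norm x)\<^sup>2" by (simp add: power_mult_distrib k_def)
    finally show ?thesis by (rule power2_le_imp_le) (simp add: k_def)
  qed
  then have "?N \<le> sqrt k" by (intro onorm_bound) (auto simp: k_def)
  then have "?N\<^sup>2 \<le> (sqrt k)\<^sup>2" using N by (intro power_mono) auto
  then have "?N\<^sup>2 \<le> k" by (simp add: k_def)
  moreover have "k < ?N\<^sup>2" using c N by (simp add: k_def)
  ultimately show False by simp
qed

text \<open>Let \<open>N = \<parallel>P(B)\<parallel>\<close>.  Since \<open>P(B)\<^sup>2 - N\<^sup>2\<close> is not bounded below, the polynomial \<open>P\<^sup>2 - N\<^sup>2\<close> has a
  root \<open>z\<close> for which \<open>B - z\<close> is not bounded below either.  This \<open>z\<close> is a point of \<open>[0, \<parallel>B\<parallel>]\<close> at which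
  \<open>|P|\<close> equals \<open>N\<close>.\<close>

lemma onorm_poly_op_le:
  assumes pos: "positive_operator B" and K: "\<And>t. t \<in> {0..onorm B} \<Longrightarrow> \<bar>poly P t\<bar> \<le> K"
  shows "onorm (poly_op P B) \<le> K"
proof -
  have B: "bounded_clinear B" using pos by (simp add: positive_operator_def)
  let ?C = "poly_op P B" and ?N = "onorm (poly_op P B)"
  have C: "bounded_linear ?C" using bounded_clinear_poly_op[OF B] bounded_clinear_bounded_linear by blast
  have "0 \<le> onorm B" using B by (simp add: onorm_pos_le bounded_clinear_bounded_linear)
  then have K0: "0 \<le> K" using K[of 0] by auto
  show ?thesis
  proof (cases "?N > 0")
    case True
    define S where "S = P * P - [:?N\<^sup>2:]"
    have "poly_op S B = (\<lambda>x. ?C (?C x) - ?N\<^sup>2 *\<^sub>R x)"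
      by (simp add: S_def fun_eq_iff poly_op_diff poly_op_mult[OF B] poly_op_const)
    moreover have "cinner (?C x) y = cinner x (?C y)" for x y
      using pos by (intro poly_op_selfadjoint) (simp add: positive_operator_def)
    ultimately have nb: "\<not> bounded_below (cpoly_op (complex_poly S) B)"
      using not_bounded_below_square_minus_onorm[OF C _ True] by (simp add: poly_op_eq_cpoly_op)
    show ?thesis
    proof (cases "S = 0")
      case True
      then have "P * P = [:?N\<^sup>2:]" by (simp add: S_def)
      then have "poly P 0 * poly P 0 = ?N\<^sup>2" by (metis poly_mult poly_0_coeff_0 coeff_pCons_0)
      then have "\<bar>poly P 0\<bar> = ?N" using \<open>?N > 0\<close> by (auto simp: power2_eq_iff simp flip: power2_eq_square)
      then show ?thesis using K[of 0] \<open>0 \<le> onorm B\<close> by simp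
    next
      case False
      then have "complex_poly S \<noteq> 0" by (simp add: map_poly_eq_0_iff)
      then obtain z where z: "poly (complex_poly S) z = 0" "\<not> bounded_below (\<lambda>x. B x - z *\<^sub>C x)"
        using not_bounded_below_imp_root[OF B _ nb] by blast
      then obtain t where t: "t \<in> {0..onorm B}" "z = complex_of_real t"
        using not_bounded_below_imp_in_interval[OF pos] by blast
      have "poly (complex_poly S) z = complex_of_real (poly S t)"
        unfolding t(2) by (induction S) (simp_all add: map_poly_pCons)
      then have "poly S t = 0" using z(1) by simp
      then have "(poly P t)\<^sup>2 = ?N\<^sup>2" by (simp add: S_def power2_eq_square)
      then have "\<bar>poly P t\<bar> = ?N" using True by (auto simp: power2_eq_iff)
      then show ?thesis using K[OF t(1)] by simp
    qed
  qed (use K0 in simp)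
qed

section \<open>Continuous functional calculus\<close>

lemma polynomial_approximation:
  assumes "continuous_on {0..M} f"
  obtains P :: "nat \<Rightarrow> real poly" where "uniform_limit {0..M} (\<lambda>n. poly (P n)) f sequentially"
proof -
  have "\<exists>p. \<forall>x\<in>{0..M}. \<bar>f x - poly p x\<bar> < 1 / (real n + 1)" for n
  proof -
    obtain g where g: "real_polynomial_function g" "\<And>x. x \<in> {0..M} \<Longrightarrow> \<bar>f x - g x\<bar> < 1 / (real n + 1)"
      using Stone_Weierstrass_real_polynomial_function[OF compact_Icc assms, of "1 / (real n + 1)"] by auto
    obtain a m where "g = (\<lambda>x. \<Sum>i\<le>m. a i * x ^ i)"
      using g(1) real_polynomial_function_iff_sum by blast
    then have "g x = poly (\<Sum>i\<le>m. monom (a i) i) x" for x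
      by (simp add: poly_sum poly_monom)
    then show ?thesis
      using g(2) by (intro exI[of _ "\<Sum>i\<le>m. monom (a i) i"]) simp
  qed
  then obtain P where P: "\<And>n x. x \<in> {0..M} \<Longrightarrow> \<bar>f x - poly (P n) x\<bar> < 1 / (real n + 1)"
    by metis
  have "uniform_limit {0..M} (\<lambda>n. poly (P n)) f sequentially"
  proof (rule uniform_limitI)
    fix e :: real assume "e > 0"
    have "(\<lambda>n. 1 / (real n + 1)) \<longlonglongrightarrow> 0"
      using LIMSEQ_inverse_real_of_nat by (simp add: inverse_eq_divide add.commute)
    then have "\<forall>\<^sub>F n in sequentially. 1 / (real n + 1) < e"
      using \<open>e > 0\<close> by (rule order_tendstoD)
    then show "\<forall>\<^sub>F n in sequentially. \<forall>x\<in>{0..M}. dist (poly (P n) x) (f x) < e"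
    proof eventually_elim
      case (elim n)
      then show ?case using P[of _ n] by (fastforce simp: dist_real_def abs_minus_commute)
    qed
  qed
  then show thesis by (rule that)
qed

lemma bounded_linear_onorm_tendsto_0:
  assumes lin: "\<And>n. bounded_linear (\<lambda>x. T x - S n x)"
    and lim: "(\<lambda>n. onorm (\<lambda>x. T x - S n x)) \<longlonglongrightarrow> 0"
  shows "(\<lambda>n. S n x) \<longlonglongrightarrow> T x"
proof -
  have "(\<lambda>n. onorm (\<lambda>x. T x - S n x) * norm x) \<longlonglongrightarrow> 0"
    using tendsto_mult_right[OF lim, of "norm x"] by simp
  then have "(\<lambda>n. T x - S n x) \<longlonglongrightarrow> 0"
    by (rule Lim_null_comparison[rotated]) (simp add: onorm[OF lin])
  then have "(\<lambda>n. T x - (T x - S n x)) \<longlonglongrightarrow> T x - 0" by (intro tendsto_intros)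
  then show ?thesis by simp
qed

text \<open>The bound \<open>\<parallel>P(B)\<parallel> \<le> sup |P|\<close> on \<open>[0, \<parallel>B\<parallel>]\<close> makes \<open>P\<^sub>n(B)\<close> a Cauchy sequence whose limit
  does not depend on the approximating polynomials.\<close>

lemma functional_calculus_limit:
  fixes B :: "'a::complex_hilbert_space \<Rightarrow> 'a"
  assumes pos: "positive_operator B" and f: "continuous_on {0..onorm B} f"
  shows "bounded_clinear (functional_calculus f B)"
    and "uniform_limit {0..onorm B} (\<lambda>n. poly (P n)) f sequentially \<Longrightarrow>
      (\<lambda>n. onorm (\<lambda>x. functional_calculus f B x - poly_op (P n) B x)) \<longlonglongrightarrow> 0"
proof -
  let ?I = "{0..onorm B}"
  define is_calculus where "is_calculus T \<longleftrightarrow> bounded_clinear T \<and>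
     (\<forall>P :: nat \<Rightarrow> real poly. uniform_limit ?I (\<lambda>n. poly (P n)) f sequentially \<longrightarrow>
        (\<lambda>n. onorm (\<lambda>x. T x - poly_op (P n) B x)) \<longlonglongrightarrow> 0)" for T
  have B: "bounded_clinear B" using pos by (simp add: positive_operator_def)
  have bc: "bounded_clinear (poly_op P B)" for P by (rule bounded_clinear_poly_op[OF B])
  have bl: "bounded_linear (poly_op P B)" for P by (rule bounded_clinear_bounded_linear[OF bc])
  obtain P0 :: "nat \<Rightarrow> real poly" where P0: "uniform_limit ?I (\<lambda>n. poly (P0 n)) f sequentially"
    using polynomial_approximation[OF f] by blast
  define S where "S n = Blinfun (poly_op (P0 n) B)" for n
  have S: "blinfun_apply (S n) = poly_op (P0 n) B" for n
    by (simp add: S_def bounded_linear_Blinfun_apply[OF bl])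
  have close: "onorm (\<lambda>x. poly_op P B x - poly_op Q B x) \<le> e"
    if "\<forall>x\<in>?I. dist (poly P x) (f x) < e / 2" "\<forall>x\<in>?I. dist (poly Q x) (f x) < e / 2" for P Q e
  proof -
    have "onorm (poly_op (P - Q) B) \<le> e"
    proof (rule onorm_poly_op_le[OF pos])
      fix t assume "t \<in> ?I"
      then have "dist (poly P t) (f t) < e / 2" "dist (poly Q t) (f t) < e / 2" using that by auto
      then show "\<bar>poly (P - Q) t\<bar> \<le> e" unfolding dist_real_def poly_diff by linarith
    qed
    moreover have "poly_op (P - Q) B = (\<lambda>x. poly_op P B x - poly_op Q B x)"
      by (simp add: fun_eq_iff poly_op_diff)
    ultimately show ?thesis by simp
  qed
  have "Cauchy S"
  proof (rule metric_CauchyI)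
    fix e :: real assume e: "e > 0"
    then have "\<forall>\<^sub>F n in sequentially. \<forall>x\<in>?I. dist (poly (P0 n) x) (f x) < (e / 2) / 2"
      using uniform_limitD[OF P0, of "e / 2 / 2"] by simp
    then obtain N where N: "\<And>n. n \<ge> N \<Longrightarrow> \<forall>x\<in>?I. dist (poly (P0 n) x) (f x) < (e / 2) / 2"
      unfolding eventually_sequentially by blast
    have "dist (S i) (S j) < e" if "i \<ge> N" "j \<ge> N" for i j
    proof -
      have "norm (S i - S j) \<le> e / 2"
        using close[OF N N, OF that] by (simp add: norm_blinfun.rep_eq S minus_blinfun.rep_eq)
      then show ?thesis using e by (simp add: dist_norm)
    qed
    then show "\<exists>N. \<forall>i\<ge>N. \<forall>j\<ge>N. dist (S i) (S j) < e" by blast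
  qed
  then obtain L where L: "S \<longlonglongrightarrow> L" using Cauchy_convergent convergent_def by blast
  let ?T = "blinfun_apply L"
  have lim: "(\<lambda>n. poly_op (P0 n) B x) \<longlonglongrightarrow> ?T x" for x
    using blinfun.tendsto[OF L tendsto_const, of x] by (simp add: S)
  have onorm_lim: "(\<lambda>n. onorm (\<lambda>x. ?T x - poly_op (P0 n) B x)) \<longlonglongrightarrow> 0"
  proof -
    have "(\<lambda>n. L - S n) \<longlonglongrightarrow> L - L" by (intro tendsto_intros L)
    then have "(\<lambda>n. norm (L - S n)) \<longlonglongrightarrow> 0" by (intro tendsto_norm_zero) simp
    then show ?thesis by (simp add: norm_blinfun.rep_eq S minus_blinfun.rep_eq)
  qed
  have T: "bounded_clinear ?T"
    unfolding bounded_clinear_def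
  proof (intro conjI allI)
    fix c x
    have "(\<lambda>n. poly_op (P0 n) B (c *\<^sub>C x)) \<longlonglongrightarrow> c *\<^sub>C ?T x"
      using bounded_linear.tendsto[OF bounded_linear_scaleC lim] by (simp add: bounded_clinear_scaleC[OF bc])
    then show "?T (c *\<^sub>C x) = c *\<^sub>C ?T x" using lim LIMSEQ_unique by blast
  qed (rule blinfun.bounded_linear_right)
  have "is_calculus ?T"
    unfolding is_calculus_def
  proof (intro conjI allI impI T)
    fix P :: "nat \<Rightarrow> real poly" assume P: "uniform_limit ?I (\<lambda>n. poly (P n)) f sequentially"
    have "(\<lambda>n. onorm (\<lambda>x. poly_op (P0 n) B x - poly_op (P n) B x)) \<longlonglongrightarrow> 0"
    proof (rule tendstoI)
      fix e :: real assume e: "e > 0"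
      have "\<forall>\<^sub>F n in sequentially. \<forall>x\<in>?I. dist (poly (P0 n) x) (f x) < (e / 2) / 2"
        "\<forall>\<^sub>F n in sequentially. \<forall>x\<in>?I. dist (poly (P n) x) (f x) < (e / 2) / 2"
        using uniform_limitD[OF P0, of "e / 2 / 2"] uniform_limitD[OF P, of "e / 2 / 2"] e by simp_all
      then show "\<forall>\<^sub>F n in sequentially. dist (onorm (\<lambda>x. poly_op (P0 n) B x - poly_op (P n) B x)) 0 < e"
      proof eventually_elim
        case (elim n)
        have "0 \<le> onorm (\<lambda>x. poly_op (P0 n) B x - poly_op (P n) B x)"
          by (intro onorm_pos_le bounded_linear_sub bl)
        then show ?case using close[OF elim] e by simp
      qed
    qed
    then have lim_sum: "(\<lambda>n. onorm (\<lambda>x. ?T x - poly_op (P0 n) B x) + onorm (\<lambda>x. poly_op (P0 n) B x - poly_op (P n) B x)) \<longlonglongrightarrow> 0"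
      using tendsto_add[OF onorm_lim] by fastforce
    have le_sum: "norm (onorm (\<lambda>x. ?T x - poly_op (P n) B x))
        \<le> onorm (\<lambda>x. ?T x - poly_op (P0 n) B x) + onorm (\<lambda>x. poly_op (P0 n) B x - poly_op (P n) B x)" for n
    proof -
      have 1: "bounded_linear (\<lambda>x. ?T x - poly_op (P0 n) B x)"
        "bounded_linear (\<lambda>x. poly_op (P0 n) B x - poly_op (P n) B x)"
        "bounded_linear (\<lambda>x. ?T x - poly_op (P n) B x)"
        by (intro bounded_linear_sub bl blinfun.bounded_linear_right)+
      have "(\<lambda>x. ?T x - poly_op (P n) B x) =
          (\<lambda>x. (?T x - poly_op (P0 n) B x) + (poly_op (P0 n) B x - poly_op (P n) B x))" by simp
      then show ?thesis using onorm_triangle[OF 1(1,2)] onorm_pos_le[OF 1(3)] by simp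
    qed
    show "(\<lambda>n. onorm (\<lambda>x. ?T x - poly_op (P n) B x)) \<longlonglongrightarrow> 0"
      by (rule Lim_null_comparison[OF always_eventually[OF allI[OF le_sum]] lim_sum])
  qed
  moreover have "T = ?T" if "is_calculus T" for T
  proof
    fix x
    have T: "bounded_clinear T" and lim_T: "(\<lambda>n. onorm (\<lambda>x. T x - poly_op (P0 n) B x)) \<longlonglongrightarrow> 0"
      using that P0 by (auto simp: is_calculus_def)
    have "bounded_linear (\<lambda>x. T x - poly_op (P0 n) B x)" for n
      by (rule bounded_linear_sub[OF bounded_clinear_bounded_linear[OF T] bl])
    then have "(\<lambda>n. poly_op (P0 n) B x) \<longlonglongrightarrow> T x"
      using lim_T by (rule bounded_linear_onorm_tendsto_0)
    then show "T x = ?T x" using lim LIMSEQ_unique by blast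
  qed
  ultimately have "is_calculus (functional_calculus f B)"
    unfolding functional_calculus_def is_calculus_def[symmetric] by (rule theI)
  then show "bounded_clinear (functional_calculus f B)"
    and "uniform_limit {0..onorm B} (\<lambda>n. poly (P n)) f sequentially \<Longrightarrow>
      (\<lambda>n. onorm (\<lambda>x. functional_calculus f B x - poly_op (P n) B x)) \<longlonglongrightarrow> 0"
    by (simp_all add: is_calculus_def)
qed

lemma functional_calculus_strong_limit:
  assumes pos: "positive_operator B" and f: "continuous_on {0..onorm B} f"
    and P: "uniform_limit {0..onorm B} (\<lambda>n. poly (P n)) f sequentially"
  shows "(\<lambda>n. poly_op (P n) B x) \<longlonglongrightarrow> functional_calculus f B x"
proof (rule bounded_linear_onorm_tendsto_0
    [where T = "functional_calculus f B" and S = "\<lambda>n. poly_op (P n) B"])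
  show "bounded_linear (\<lambda>x. functional_calculus f B x - poly_op (P n) B x)" for n
    using pos by (intro bounded_linear_sub bounded_clinear_bounded_linear bounded_clinear_poly_op
        functional_calculus_limit(1)[OF pos f]) (simp add: positive_operator_def)
qed (rule functional_calculus_limit(2)[OF pos f P])

lemma functional_calculus_selfadjoint:
  assumes pos: "positive_operator B" and f: "continuous_on {0..onorm B} f"
  shows "cinner (functional_calculus f B x) y = cinner x (functional_calculus f B y)"
proof -
  obtain P where P: "uniform_limit {0..onorm B} (\<lambda>n. poly (P n)) f sequentially"
    using polynomial_approximation[OF f] by blast
  note lim = functional_calculus_strong_limit[OF pos f P]
  have "(\<lambda>n. cinner (poly_op (P n) B x) y) \<longlonglongrightarrow> cinner (functional_calculus f B x) y"
    by (intro cinner.tendsto lim tendsto_const)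
  moreover have "(\<lambda>n. cinner x (poly_op (P n) B y)) \<longlonglongrightarrow> cinner x (functional_calculus f B y)"
    by (intro cinner.tendsto lim tendsto_const)
  moreover have "cinner (poly_op (P n) B x) y = cinner x (poly_op (P n) B y)" for n
    using pos by (intro poly_op_selfadjoint) (simp add: positive_operator_def)
  ultimately show ?thesis using LIMSEQ_unique by auto
qed

lemma continuous_on_powr_const: "s > 0 \<Longrightarrow> continuous_on {0..} (\<lambda>t::real. t powr s)"
  by (rule continuous_on_powr'[OF continuous_on_id continuous_on_const]) auto

text \<open>If the polynomials \<open>P\<^sub>n\<close> approximate the square root, then \<open>P\<^sub>n\<^sup>2\<close> approximates the identity
  function, and \<open>P\<^sub>n(B)\<^sup>2\<close> converges both to \<open>B\<close> and to the square of the square root of \<open>B\<close>.\<close>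

lemma functional_calculus_sqrt:
  assumes pos: "positive_operator B"
  shows "functional_calculus (\<lambda>t. t powr (1/2)) B (functional_calculus (\<lambda>t. t powr (1/2)) B x) = B x"
proof -
  let ?f = "\<lambda>t::real. t powr (1/2)" and ?I = "{0..onorm B}"
  let ?R = "functional_calculus ?f B"
  have B: "bounded_clinear B" using pos by (simp add: positive_operator_def)
  have f: "continuous_on ?I ?f" by (rule continuous_on_subset[OF continuous_on_powr_const]) auto
  obtain P where P: "uniform_limit ?I (\<lambda>n. poly (P n)) ?f sequentially"
    using polynomial_approximation[OF f] by blast
  note lim = functional_calculus_strong_limit[OF pos f P]
  have bl: "bounded_linear (\<lambda>x. ?R x - poly_op (P n) B x)" for n
    by (intro bounded_linear_sub bounded_clinear_bounded_linear bounded_clinear_poly_op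
        functional_calculus_limit(1)[OF pos f] B)
  have "uniform_limit ?I (\<lambda>n t. poly (P n) t * poly (P n) t) (\<lambda>t. ?f t * ?f t) sequentially"
    by (intro uniform_lim_mult P compact_imp_bounded compact_continuous_image f compact_Icc)
  then have square: "uniform_limit ?I (\<lambda>n. poly (P n * P n)) (\<lambda>t. t) sequentially"
    by (rule uniform_limit_cong'[THEN iffD1, rotated -1]) (simp_all flip: powr_add)
  have id: "continuous_on ?I (\<lambda>t. t)" by (rule continuous_on_id)
  have "poly [:0, 1:] = (\<lambda>t::real. t)" by auto
  then have "uniform_limit ?I (\<lambda>n::nat. poly [:0, 1:]) (\<lambda>t. t) sequentially"
    by (intro uniform_limitI) simp
  then have "(\<lambda>n::nat. poly_op [:0, 1:] B x) \<longlonglongrightarrow> functional_calculus (\<lambda>t. t) B x"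
    by (rule functional_calculus_strong_limit[OF pos id])
  then have "functional_calculus (\<lambda>t. t) B x = B x"
    by (simp add: LIMSEQ_const_iff poly_op_def)
  moreover have "(\<lambda>n. poly_op (P n * P n) B x) \<longlonglongrightarrow> functional_calculus (\<lambda>t. t) B x"
    by (rule functional_calculus_strong_limit[OF pos id square])
  moreover have "(\<lambda>n. poly_op (P n) B (poly_op (P n) B x)) \<longlonglongrightarrow> ?R (?R x)"
  proof -
    let ?y = "\<lambda>n. poly_op (P n) B x"
    have "(\<lambda>n. onorm (\<lambda>x. ?R x - poly_op (P n) B x) * norm (?y n)) \<longlonglongrightarrow> 0 * norm (?R x)"
      by (rule tendsto_mult[OF functional_calculus_limit(2)[OF pos f P] tendsto_norm[OF lim]])
    then have lim_0: "(\<lambda>n. onorm (\<lambda>x. ?R x - poly_op (P n) B x) * norm (?y n)) \<longlonglongrightarrow> 0"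
      by simp
    have "(\<lambda>n. ?R (?y n) - poly_op (P n) B (?y n)) \<longlonglongrightarrow> 0"
      by (rule Lim_null_comparison[OF always_eventually[OF allI[OF onorm[OF bl]]] lim_0])
    moreover have "(\<lambda>n. ?R (?y n)) \<longlonglongrightarrow> ?R (?R x)"
      by (rule bounded_linear.tendsto[OF bounded_clinear_bounded_linear[OF functional_calculus_limit(1)[OF pos f]] lim])
    ultimately have "(\<lambda>n. ?R (?y n) - (?R (?y n) - poly_op (P n) B (?y n))) \<longlonglongrightarrow> ?R (?R x) - 0"
      by (rule tendsto_diff[rotated])
    then show ?thesis by simp
  qed
  ultimately show ?thesis using LIMSEQ_unique by (auto simp: poly_op_mult[OF B])
qed

text \<open>The norm of a diagonal operator is at least that of each block, so polynomials that
  approximate \<open>f\<close> for the diagonal operator do so for the blocks.\<close>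

lemma functional_calculus_diagonal:
  assumes pos: "positive_operator B" "positive_operator C" and f: "continuous_on {0..} f"
  shows "functional_calculus f (\<lambda>(x, y). (B x, C y))
    = (\<lambda>(x, y). (functional_calculus f B x, functional_calculus f C y))"
proof -
  let ?D = "\<lambda>(x, y). (B x, C y)"
  have D_eq: "?D = (\<lambda>p. (B (fst p), C (snd p)))" by auto
  have B: "bounded_clinear B" and C: "bounded_clinear C" using pos by (auto simp: positive_operator_def)
  have D: "bounded_clinear ?D"
    unfolding D_eq
    by (intro bounded_clinear_Pair bounded_clinear_compose[OF B] bounded_clinear_compose[OF C]
        bounded_clinear_fst bounded_clinear_snd)
  have posD: "positive_operator ?D"
    using pos D by (auto simp: positive_operator_def cinner_prod_def)
  note onorm_D = onorm[OF bounded_clinear_bounded_linear[OF D]]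
  have nonneg: "0 \<le> onorm ?D" by (rule onorm_pos_le[OF bounded_clinear_bounded_linear[OF D]])
  have "norm (B x) \<le> onorm ?D * norm x" for x
  proof -
    have "norm (B x, C 0) \<le> onorm ?D * norm (x, 0)" using onorm_D[of "(x, 0)"] by simp
    moreover have "norm (x, 0) = norm x" by (simp add: norm_Pair)
    ultimately show ?thesis using norm_fst_le[of "B x" "C 0"] by simp
  qed
  then have leB: "onorm B \<le> onorm ?D" using nonneg by (rule onorm_bound[rotated])
  have "norm (C y) \<le> onorm ?D * norm y" for y
  proof -
    have "norm (B 0, C y) \<le> onorm ?D * norm (0, y)" using onorm_D[of "(0, y)"] by simp
    moreover have "norm (0, y) = norm y" by (simp add: norm_Pair)
    ultimately show ?thesis using norm_snd_le[of "C y" "B 0"] by simp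
  qed
  then have leC: "onorm C \<le> onorm ?D" using nonneg by (rule onorm_bound[rotated])
  have cont: "continuous_on {0..M} f" for M by (rule continuous_on_subset[OF f]) auto
  obtain P where P: "uniform_limit {0..onorm ?D} (\<lambda>n. poly (P n)) f sequentially"
    using polynomial_approximation[OF cont] by blast
  have PB: "uniform_limit {0..onorm B} (\<lambda>n. poly (P n)) f sequentially"
    and PC: "uniform_limit {0..onorm C} (\<lambda>n. poly (P n)) f sequentially"
    using leB leC by (auto intro: uniform_limit_on_subset[OF P])
  have "(?D ^^ i) (x, y) = ((B ^^ i) x, (C ^^ i) y)" for i x y
    by (induction i) auto
  then have poly_op_D: "poly_op Q ?D (x, y) = (poly_op Q B x, poly_op Q C y)" for Q x y
    by (simp add: poly_op_def sum_prod)
  have "functional_calculus f ?D (x, y) = (functional_calculus f B x, functional_calculus f C y)" for x y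
  proof (rule LIMSEQ_unique)
    show "(\<lambda>n. poly_op (P n) ?D (x, y)) \<longlonglongrightarrow> functional_calculus f ?D (x, y)"
      by (rule functional_calculus_strong_limit[OF posD cont P])
    show "(\<lambda>n. poly_op (P n) ?D (x, y)) \<longlonglongrightarrow> (functional_calculus f B x, functional_calculus f C y)"
      unfolding poly_op_D
      by (intro tendsto_Pair functional_calculus_strong_limit[OF pos(1) cont PB]
          functional_calculus_strong_limit[OF pos(2) cont PC])
  qed
  then show ?thesis by (simp add: fun_eq_iff)
qed

section \<open>The inverse of \<open>1 + D\<^sup>*D\<close> and its square root\<close>

lemma csubspace_closure:
  fixes M :: "'a::complex_hilbert_space set"
  assumes M: "csubspace M" shows "csubspace (closure M)"
proof (rule complex_vector.subspaceI)
  show "0 \<in> closure M"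
    using complex_vector.subspace_0[OF M] closure_subset by blast
next
  fix x y assume "x \<in> closure M" "y \<in> closure M"
  then obtain f g where "\<And>n. f n \<in> M" "f \<longlonglongrightarrow> x" "\<And>n. g n \<in> M" "g \<longlonglongrightarrow> y"
    unfolding closure_sequential by blast
  then show "x + y \<in> closure M"
    unfolding closure_sequential
    by (intro exI[of _ "\<lambda>n. f n + g n"]) (auto intro: tendsto_add complex_vector.subspace_add[OF M])
next
  fix c x assume "x \<in> closure M"
  then obtain f where "\<And>n. f n \<in> M" "f \<longlonglongrightarrow> x"
    unfolding closure_sequential by blast
  then show "c *\<^sub>C x \<in> closure M"
    unfolding closure_sequential
    by (intro exI[of _ "\<lambda>n. c *\<^sub>C f n"])
      (auto intro: bounded_linear.tendsto[OF bounded_linear_scaleC] complex_vector.subspace_scale[OF M])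
qed

lemma csubspace_range:
  assumes T: "bounded_clinear T" shows "csubspace (range T)"
proof (rule complex_vector.subspaceI)
  note T_simps = linear_simps[OF bounded_clinear_bounded_linear[OF T]]
  show "0 \<in> range T" using T_simps(3) by (metis rangeI)
  fix x y assume "x \<in> range T" "y \<in> range T"
  then obtain u v where "x = T u" "y = T v" by blast
  then have "x + y = T (u + v)" by (simp add: T_simps)
  then show "x + y \<in> range T" by simp
next
  fix c x assume "x \<in> range T"
  then obtain u where "x = T u" by blast
  then have "c *\<^sub>C x = T (c *\<^sub>C u)" by (simp add: bounded_clinear_scaleC[OF T])
  then show "c *\<^sub>C x \<in> range T" by simp
qed

text \<open>Applied with \<open>N\<close> the whole space this gives density; with \<open>N\<close> the graph of a closed operator it
  shows that a subspace of the graph is a core.\<close>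

lemma subset_closure_if_orthogonal_trivial:
  fixes M N :: "'a::complex_hilbert_space set"
  assumes M: "csubspace M" and N: "csubspace N" "closed N" and sub: "M \<subseteq> N"
    and orth: "\<And>e. e \<in> N \<Longrightarrow> (\<And>m. m \<in> M \<Longrightarrow> cinner m e = 0) \<Longrightarrow> e = 0"
  shows "N \<subseteq> closure M"
proof
  fix x assume x: "x \<in> N"
  obtain y where y: "y \<in> closure M" "\<And>m. m \<in> closure M \<Longrightarrow> cinner m (x - y) = 0"
    using closed_csubspace_projection[OF csubspace_closure[OF M] closed_closure] by blast
  have "y \<in> N" using y(1) sub N(2) closure_minimal by blast
  then have "x - y \<in> N" using complex_vector.subspace_diff[OF N(1) x] by blast
  then have "x - y = 0" using orth y(2) closure_subset by blast
  then show "x \<in> closure M" using y(1) by simp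
qed

definition closed_operator :: "('a::complex_hilbert_space \<times> 'a) set \<Rightarrow> bool" where
  "closed_operator D \<longleftrightarrow> linear_operator D \<and> densely_defined D \<and> closed D"

lemma closed_operatorD:
  assumes "closed_operator D"
  shows "csubspace D" "single_valued D" "densely_defined D" "closed D"
  using assms by (auto simp: closed_operator_def linear_operator_def)

lemma op_adjoint_cinner: "(y, z) \<in> D\<^sup>\<star> \<Longrightarrow> (x, w) \<in> D \<Longrightarrow> cinner y w = cinner z x"
  by (auto simp: op_adjoint_iff)

text \<open>Two solutions of \<open>(1 + D\<^sup>*D) y = x\<close> differ by some \<open>u\<close> with \<open>\<parallel>u\<parallel>\<^sup>2 + \<parallel>D u\<parallel>\<^sup>2 = 0\<close>.\<close>

lemma inverse_one_plus_eqI: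
  assumes D: "csubspace D" and y: "(y, z) \<in> D" "(z, x - y) \<in> D\<^sup>\<star>"
  shows "inverse_one_plus (D O D\<^sup>\<star>) x = y"
  unfolding inverse_one_plus_def
proof (rule the_equality)
  show "(y, x - y) \<in> D O D\<^sup>\<star>" using y by blast
next
  fix y' assume "(y', x - y') \<in> D O D\<^sup>\<star>"
  then obtain z' where y': "(y', z') \<in> D" "(z', x - y') \<in> D\<^sup>\<star>" by blast
  have 1: "(y' - y, z' - z) \<in> D" using complex_vector.subspace_diff[OF D y'(1) y(1)] by simp
  have 2: "(z' - z, y - y') \<in> D\<^sup>\<star>"
    using complex_vector.subspace_diff[OF csubspace_op_adjoint y'(2) y(2)] by simp
  have "cinner (z' - z) (z' - z) = cinner (y - y') (y' - y)" by (rule op_adjoint_cinner[OF 2 1])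
  also have "\<dots> = - cinner (y' - y) (y' - y)" by (metis cinner.minus_left minus_diff_eq)
  finally have "(norm (z' - z))\<^sup>2 = - (norm (y' - y))\<^sup>2"
    by (metis cinner_self_Re uminus_complex.sel(1))
  then have "norm (y' - y) = 0" by (smt (verit) zero_le_power2 zero_less_power2)
  then show "y' = y" by simp
qed

text \<open>Von Neumann's argument: the graph component \<open>(y, D y)\<close> of \<open>(x, 0)\<close> satisfies
  \<open>D\<^sup>*D y = x - y\<close>.\<close>

lemma inverse_one_plus_graph:
  assumes D: "csubspace D" "closed D"
  obtains z where "(inverse_one_plus (D O D\<^sup>\<star>) x, z) \<in> D" "(z, x - inverse_one_plus (D O D\<^sup>\<star>) x) \<in> D\<^sup>\<star>"
proof -
  obtain y z where y: "(y, z) \<in> D" "(0 - z, y - x) \<in> D\<^sup>\<star>"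
    using graph_decomposition[OF D] by blast
  have "(z, x - y) \<in> D\<^sup>\<star>"
    using complex_vector.subspace_neg[OF csubspace_op_adjoint y(2)] by simp
  then show thesis using that inverse_one_plus_eqI[OF D(1) y(1)] y(1) by simp
qed

lemma inverse_one_plus_cinner:
  assumes D: "csubspace D" "closed D"
    and z: "(inverse_one_plus (D O D\<^sup>\<star>) x, z) \<in> D"
    and z': "(z', x' - inverse_one_plus (D O D\<^sup>\<star>) x') \<in> D\<^sup>\<star>"
  shows "cinner x' (inverse_one_plus (D O D\<^sup>\<star>) x)
    = cinner (inverse_one_plus (D O D\<^sup>\<star>) x') (inverse_one_plus (D O D\<^sup>\<star>) x) + cinner z' z"
  using op_adjoint_cinner[OF z' z] by (simp add: cinner.diff_left)

lemma positive_operator_inverse_one_plus: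
  assumes D: "csubspace D" "closed D"
  shows "positive_operator (inverse_one_plus (D O D\<^sup>\<star>))"
proof -
  let ?Q = "inverse_one_plus (D O D\<^sup>\<star>)"
  have add: "?Q (x + y) = ?Q x + ?Q y" for x y
  proof -
    obtain z where z: "(?Q x, z) \<in> D" "(z, x - ?Q x) \<in> D\<^sup>\<star>" by (rule inverse_one_plus_graph[OF D])
    obtain w where w: "(?Q y, w) \<in> D" "(w, y - ?Q y) \<in> D\<^sup>\<star>" by (rule inverse_one_plus_graph[OF D])
    show ?thesis
    proof (rule inverse_one_plus_eqI[OF D(1)])
      show "(?Q x + ?Q y, z + w) \<in> D" using complex_vector.subspace_add[OF D(1) z(1) w(1)] by simp
      show "(z + w, x + y - (?Q x + ?Q y)) \<in> D\<^sup>\<star>"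
        using complex_vector.subspace_add[OF csubspace_op_adjoint z(2) w(2)] by (simp add: algebra_simps)
    qed
  qed
  have scale: "?Q (c *\<^sub>C x) = c *\<^sub>C ?Q x" for c x
  proof -
    obtain z where z: "(?Q x, z) \<in> D" "(z, x - ?Q x) \<in> D\<^sup>\<star>" by (rule inverse_one_plus_graph[OF D])
    show ?thesis
    proof (rule inverse_one_plus_eqI[OF D(1)])
      show "(c *\<^sub>C ?Q x, c *\<^sub>C z) \<in> D"
        using complex_vector.subspace_scale[OF D(1) z(1), of c] by (simp add: scaleC_prod_def)
      show "(c *\<^sub>C z, c *\<^sub>C x - c *\<^sub>C ?Q x) \<in> D\<^sup>\<star>"
        using complex_vector.subspace_scale[OF csubspace_op_adjoint z(2), of c]
        by (simp add: scaleC_prod_def complex_vector.scale_right_diff_distrib)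
    qed
  qed
  have sa: "cinner (?Q x) y = cinner x (?Q y)" for x y
  proof -
    obtain z where z: "(?Q x, z) \<in> D" "(z, x - ?Q x) \<in> D\<^sup>\<star>" by (rule inverse_one_plus_graph[OF D])
    obtain w where w: "(?Q y, w) \<in> D" "(w, y - ?Q y) \<in> D\<^sup>\<star>" by (rule inverse_one_plus_graph[OF D])
    have "cinner y (?Q x) = cinner (?Q y) (?Q x) + cinner w z"
      by (rule inverse_one_plus_cinner[OF D z(1) w(2)])
    then have "cinner (?Q x) y = cinner (?Q x) (?Q y) + cinner z w"
      by (metis cinner_commute complex_cnj_add)
    also have "\<dots> = cinner x (?Q y)"
      by (rule inverse_one_plus_cinner[OF D w(1) z(2), symmetric])
    finally show ?thesis .
  qed
  have pos: "(norm (?Q x))\<^sup>2 \<le> Re (cinner x (?Q x))" for x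
  proof -
    obtain z where z: "(?Q x, z) \<in> D" "(z, x - ?Q x) \<in> D\<^sup>\<star>" by (rule inverse_one_plus_graph[OF D])
    show ?thesis using inverse_one_plus_cinner[OF D z] by (simp add: cinner_self_Re)
  qed
  have "norm (?Q x) \<le> norm x" for x
  proof (cases "?Q x = 0")
    case False
    have "norm (?Q x) * norm (?Q x) \<le> norm x * norm (?Q x)"
      using pos[of x] complex_Re_le_cmod[of "cinner x (?Q x)"] norm_cinner_le[of x "?Q x"]
      by (simp add: power2_eq_square)
    then show ?thesis using False by simp
  qed simp
  then have "bounded_linear ?Q"
    by (intro bounded_linear_intro[where K = 1]) (simp_all add: add scale flip: scaleC_of_real)
  moreover have "0 \<le> Re (cinner x (?Q x))" for x
    using pos[of x] zero_le_power2 order_trans by blast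
  ultimately show ?thesis
    by (simp add: positive_operator_def bounded_clinear_def scale sa)
qed

abbreviation inverse_sqrt_one_plus ::
    "('a::complex_hilbert_space \<times> 'a) set \<Rightarrow> ('a \<Rightarrow> 'a)" where
  "inverse_sqrt_one_plus D \<equiv> one_plus_neg_power (D O D\<^sup>\<star>) (1/2)"

lemma bounded_clinear_one_plus_neg_power:
  assumes D: "csubspace D" "closed D" and s: "s > 0"
  shows "bounded_clinear (one_plus_neg_power (D O D\<^sup>\<star>) s)"
  unfolding one_plus_neg_power_def
  by (rule functional_calculus_limit(1)[OF positive_operator_inverse_one_plus[OF D]])
    (rule continuous_on_subset[OF continuous_on_powr_const[OF s]], auto)

lemma inverse_sqrt_one_plus_selfadjoint:
  assumes D: "csubspace D" "closed D"
  shows "cinner (inverse_sqrt_one_plus D x) y = cinner x (inverse_sqrt_one_plus D y)"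
  unfolding one_plus_neg_power_def
  by (rule functional_calculus_selfadjoint[OF positive_operator_inverse_one_plus[OF D]])
    (rule continuous_on_subset[OF continuous_on_powr_const], auto)

lemma inverse_sqrt_one_plus_twice:
  assumes D: "csubspace D" "closed D"
  shows "inverse_sqrt_one_plus D (inverse_sqrt_one_plus D x) = inverse_one_plus (D O D\<^sup>\<star>) x"
  unfolding one_plus_neg_power_def
  by (rule functional_calculus_sqrt[OF positive_operator_inverse_one_plus[OF D]])

text \<open>With \<open>Q = (1 + D\<^sup>*D)\<^sup>-\<^sup>1\<close> and \<open>R\<close> its square root, \<open>\<parallel>R x\<parallel>\<^sup>2 = \<langle>x, Q x\<rangle>\<close> is the squared graph
  norm of \<open>Q x\<close>.\<close>

lemma norm_inverse_sqrt_one_plus: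
  assumes D: "csubspace D" "closed D"
    and z: "(inverse_one_plus (D O D\<^sup>\<star>) x, z) \<in> D" "(z, x - inverse_one_plus (D O D\<^sup>\<star>) x) \<in> D\<^sup>\<star>"
  shows "norm (inverse_sqrt_one_plus D x) = norm (inverse_one_plus (D O D\<^sup>\<star>) x, z)"
proof -
  let ?R = "inverse_sqrt_one_plus D" and ?Q = "inverse_one_plus (D O D\<^sup>\<star>)"
  have "cinner (?R x) (?R x) = cinner x (?Q x)"
    by (simp add: inverse_sqrt_one_plus_selfadjoint[OF D] inverse_sqrt_one_plus_twice[OF D])
  then have "(norm (?R x))\<^sup>2 = (norm (?Q x))\<^sup>2 + (norm z)\<^sup>2"
    using inverse_one_plus_cinner[OF D z] by (metis cinner_self_Re plus_complex.sel(1))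
  then show ?thesis by (simp add: norm_Pair real_sqrt_unique)
qed

text \<open>The range of a self-adjoint operator is dense if its kernel is zero, and the kernel of \<open>R\<close> is
  contained in that of \<open>R\<^sup>2 = (1 + D\<^sup>*D)\<^sup>-\<^sup>1\<close>.\<close>

lemma range_inverse_sqrt_one_plus_dense:
  assumes D: "closed_operator D"
  shows "closure (range (inverse_sqrt_one_plus D)) = UNIV"
proof -
  note D' = closed_operatorD(1,4)[OF D]
  let ?R = "inverse_sqrt_one_plus D" and ?Q = "inverse_one_plus (D O D\<^sup>\<star>)"
  have R: "bounded_clinear ?R" by (rule bounded_clinear_one_plus_neg_power[OF D']) simp
  interpret R: bounded_linear ?R by (rule bounded_clinear_bounded_linear[OF R])
  have "UNIV \<subseteq> closure (range ?R)"
  proof (rule subset_closure_if_orthogonal_trivial)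
    show "csubspace (range ?R)" by (rule csubspace_range[OF R])
    fix e assume e: "\<And>m. m \<in> range ?R \<Longrightarrow> cinner m e = 0"
    have "cinner x (?R e) = 0" for x
      using e[of "?R x"] inverse_sqrt_one_plus_selfadjoint[OF D'] by simp
    then have "?R e = 0" by (intro cinner_ext) (simp add: cinner.zero_right)
    then have Qe: "?Q e = 0"
      using inverse_sqrt_one_plus_twice[OF D', of e] by (simp add: R.zero)
    obtain z where z: "(?Q e, z) \<in> D" "(z, e - ?Q e) \<in> D\<^sup>\<star>" by (rule inverse_one_plus_graph[OF D'])
    have "z = 0"
      using z(1) Qe complex_vector.subspace_0[OF D'(1)] closed_operatorD(2)[OF D]
      by (auto simp: zero_prod_def dest: single_valuedD)
    then have "(0, e) \<in> D\<^sup>\<star>" using z(2) Qe by simp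
    then show "e = 0"
      using complex_vector.subspace_0[OF csubspace_op_adjoint]
        single_valued_op_adjoint[OF closed_operatorD(3)[OF D]]
      by (metis single_valuedD zero_prod_def)
  qed auto
  then show ?thesis by blast
qed

text \<open>On the dense range of \<open>R = (1 + D\<^sup>*D)\<^sup>-\<^sup>1\<^sup>/\<^sup>2\<close> the operator \<open>D R\<close> is a contraction, because
  \<open>\<parallel>R\<^sup>2y\<parallel>\<^sup>2 + \<parallel>D R\<^sup>2y\<parallel>\<^sup>2 = \<parallel>R y\<parallel>\<^sup>2\<close>; closedness of \<open>D\<close> carries this over to all vectors.\<close>

lemma inverse_sqrt_one_plus_graph:
  assumes D: "closed_operator D"
  obtains w where "(inverse_sqrt_one_plus D x, w) \<in> D" "norm w \<le> norm x"
proof -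
  note D' = closed_operatorD(1,4)[OF D]
  let ?R = "inverse_sqrt_one_plus D" and ?Q = "inverse_one_plus (D O D\<^sup>\<star>)"
  have R: "bounded_clinear ?R" by (rule bounded_clinear_one_plus_neg_power[OF D']) simp
  interpret R: bounded_linear ?R by (rule bounded_clinear_bounded_linear[OF R])
  have Q: "bounded_linear ?Q"
    using positive_operator_inverse_one_plus[OF D'] by (simp add: positive_operator_def bounded_clinear_def)
  have "x \<in> closure (range ?R)" using range_inverse_sqrt_one_plus_dense[OF D] by blast
  then obtain f where f: "\<And>n. f n \<in> range ?R" and fx: "f \<longlonglongrightarrow> x"
    unfolding closure_sequential by blast
  obtain y where y: "\<And>n. f n = ?R (y n)"
    using f unfolding image_iff by metis
  have "\<exists>z. (?Q u, z) \<in> D \<and> (z, u - ?Q u) \<in> D\<^sup>\<star>" for u by (rule inverse_one_plus_graph[OF D', of u]) blast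
  then obtain Z where Z: "\<And>u. (?Q u, Z u) \<in> D" "\<And>u. (Z u, u - ?Q u) \<in> D\<^sup>\<star>" by metis
  have norm_Z: "norm (Z u) \<le> norm (?R u)" for u
    using norm_inverse_sqrt_one_plus[OF D' Z] norm_snd_le[of "Z u" "?Q u"] by simp
  have Z_diff: "Z (u - v) = Z u - Z v" for u v
  proof (rule single_valuedD[OF closed_operatorD(2)[OF D] Z(1)])
    show "(?Q (u - v), Z u - Z v) \<in> D"
      using complex_vector.subspace_diff[OF D'(1) Z(1) Z(1), of u v]
      by (simp add: linear_simps(2)[OF Q])
  qed
  have "Cauchy (\<lambda>n. Z (y n))"
  proof (rule metric_CauchyI)
    fix e :: real assume "e > 0"
    then obtain N where N: "\<And>i j. i \<ge> N \<Longrightarrow> j \<ge> N \<Longrightarrow> dist (f i) (f j) < e"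
      using LIMSEQ_imp_Cauchy[OF fx] metric_CauchyD by blast
    have "dist (Z (y i)) (Z (y j)) \<le> dist (f i) (f j)" for i j
      using norm_Z[of "y i - y j"] by (simp add: dist_norm Z_diff y R.diff)
    then show "\<exists>N. \<forall>i\<ge>N. \<forall>j\<ge>N. dist (Z (y i)) (Z (y j)) < e"
      using N order_le_less_trans by blast
  qed
  then obtain w where w: "(\<lambda>n. Z (y n)) \<longlonglongrightarrow> w" using Cauchy_convergent convergent_def by blast
  have "(\<lambda>n. ?R (f n)) \<longlonglongrightarrow> ?R x" by (rule R.tendsto[OF fx])
  then have "(\<lambda>n. (?Q (y n), Z (y n))) \<longlonglongrightarrow> (?R x, w)"
    by (intro tendsto_Pair w) (simp add: y inverse_sqrt_one_plus_twice[OF D'])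
  then have "(?R x, w) \<in> D"
    using closed_sequentially[OF D'(2), of "\<lambda>n. (?Q (y n), Z (y n))"] Z(1) by simp
  moreover have "norm w \<le> norm x"
    using LIMSEQ_le[OF tendsto_norm[OF w] tendsto_norm[OF fx]] norm_Z by (auto simp: y)
  ultimately show thesis by (rule that)
qed

text \<open>The vectors \<open>R\<^sup>2y\<close> form a core of \<open>D\<close>, and \<open>R\<^sup>2y = R(R y)\<close> where \<open>\<parallel>R y\<parallel>\<close> is the graph norm of
  \<open>R\<^sup>2y\<close>.  So the graph-norm unit ball of \<open>dom(D)\<close> consists of limits of vectors in the image of
  the unit ball under \<open>R\<close>.\<close>

lemma image_graph_ball_subset_closure:
  assumes D: "closed_operator D" and b: "bounded_clinear b"
    and xw: "(x, w) \<in> D" "norm (x, w) < 1"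
  shows "b x \<in> closure ((b \<circ> inverse_sqrt_one_plus D) ` cball 0 1)"
proof -
  note D' = closed_operatorD(1,4)[OF D]
  let ?R = "inverse_sqrt_one_plus D" and ?Q = "inverse_one_plus (D O D\<^sup>\<star>)"
  define M where "M = {(?Q y, z) |y z. (?Q y, z) \<in> D \<and> (z, y - ?Q y) \<in> D\<^sup>\<star>}"
  have Q: "bounded_clinear ?Q"
    using positive_operator_inverse_one_plus[OF D'] by (simp add: positive_operator_def)
  note Q_simps = linear_simps[OF bounded_clinear_bounded_linear[OF Q]] bounded_clinear_scaleC[OF Q]
  have M: "csubspace M"
  proof (rule complex_vector.subspaceI)
    show "0 \<in> M"
      using complex_vector.subspace_0[OF D'(1)] complex_vector.subspace_0[OF csubspace_op_adjoint[of D]]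
      unfolding M_def zero_prod_def by (intro CollectI exI[of _ 0]) (simp add: Q_simps)
  next
    fix p q assume "p \<in> M" "q \<in> M"
    then obtain y z y' z' where
      p: "p = (?Q y, z)" "(?Q y, z) \<in> D" "(z, y - ?Q y) \<in> D\<^sup>\<star>"
      and q: "q = (?Q y', z')" "(?Q y', z') \<in> D" "(z', y' - ?Q y') \<in> D\<^sup>\<star>"
      unfolding M_def by blast
    show "p + q \<in> M"
      unfolding M_def
      using complex_vector.subspace_add[OF D'(1) p(2) q(2)]
        complex_vector.subspace_add[OF csubspace_op_adjoint p(3) q(3)]
      by (intro CollectI exI[of _ "y + y'"] exI[of _ "z + z'"])
        (simp add: p(1) q(1) Q_simps algebra_simps)
  next
    fix c p assume "p \<in> M"
    then obtain y z where p: "p = (?Q y, z)" "(?Q y, z) \<in> D" "(z, y - ?Q y) \<in> D\<^sup>\<star>"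
      unfolding M_def by blast
    show "c *\<^sub>C p \<in> M"
      unfolding M_def
      using complex_vector.subspace_scale[OF D'(1) p(2), of c]
        complex_vector.subspace_scale[OF csubspace_op_adjoint p(3), of c]
      by (intro CollectI exI[of _ "c *\<^sub>C y"] exI[of _ "c *\<^sub>C z"])
        (simp add: p(1) Q_simps scaleC_prod_def complex_vector.scale_right_diff_distrib)
  qed
  have "D \<subseteq> closure M"
  proof (rule subset_closure_if_orthogonal_trivial[OF M D'])
    show "M \<subseteq> D" by (auto simp: M_def)
    fix e assume e: "e \<in> D" and orth: "\<And>m. m \<in> M \<Longrightarrow> cinner m e = 0"
    obtain e1 e2 where e12: "e = (e1, e2)" by fastforce
    have "cinner y e1 = cinner y 0" for y
    proof -
      obtain z where z: "(?Q y, z) \<in> D" "(z, y - ?Q y) \<in> D\<^sup>\<star>" by (rule inverse_one_plus_graph[OF D'])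
      then have "(?Q y, z) \<in> M" by (auto simp: M_def)
      then have "cinner (?Q y) e1 + cinner z e2 = 0" using orth by (fastforce simp: e12 cinner_prod_def)
      moreover have "cinner z e2 = cinner (y - ?Q y) e1"
        using op_adjoint_cinner z(2) e e12 by blast
      ultimately show ?thesis by (simp add: cinner.diff_left cinner.zero_right)
    qed
    then have "e1 = 0" by (rule cinner_ext)
    moreover have "(0, 0) \<in> D" using complex_vector.subspace_0[OF D'(1)] by (simp add: zero_prod_def)
    ultimately show "e = 0"
      using e closed_operatorD(2)[OF D] by (auto simp: e12 zero_prod_def dest: single_valuedD)
  qed
  then have "(x, w) \<in> ball 0 1 \<inter> closure M" using xw by auto
  then have "(x, w) \<in> closure (ball 0 1 \<inter> M)"
    using open_Int_closure_subset[OF open_ball] by blast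
  moreover have "(b \<circ> fst) ` closure (ball 0 1 \<inter> M) \<subseteq> closure ((b \<circ> ?R) ` cball 0 1)"
  proof (rule image_closure_subset)
    show "continuous_on (closure (ball 0 1 \<inter> M)) (b \<circ> fst)"
      by (intro continuous_on_compose continuous_intros linear_continuous_on
          bounded_clinear_bounded_linear b)
    show "(b \<circ> fst) ` (ball 0 1 \<inter> M) \<subseteq> closure ((b \<circ> ?R) ` cball 0 1)"
    proof clarify
      fix p z assume p: "(p, z) \<in> ball 0 1" "(p, z) \<in> M"
      then obtain y where y: "p = ?Q y" "(?Q y, z) \<in> D" "(z, y - ?Q y) \<in> D\<^sup>\<star>"
        by (auto simp: M_def)
      \<comment> \<open>The preimage \<open>R y\<close> of \<open>R\<^sup>2y\<close> stays in the unit ball since its norm is a graph norm.\<close>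
      have "norm (?R y) \<le> 1"
        using norm_inverse_sqrt_one_plus[OF D' y(2,3)] p(1) y(1) by simp
      then have "(b \<circ> ?R) (?R y) \<in> (b \<circ> ?R) ` cball 0 1" by (intro imageI) simp
      moreover have "(b \<circ> ?R) (?R y) = b p"
        by (simp add: y(1) inverse_sqrt_one_plus_twice[OF D'])
      ultimately show "(b \<circ> fst) (p, z) \<in> closure ((b \<circ> ?R) ` cball 0 1)"
        using closure_subset by fastforce
    qed
  qed simp
  ultimately show ?thesis by force
qed

section \<open>Compact operators\<close>

lemma compact_operatorI:
  assumes "bounded_clinear T" "T ` cball 0 1 \<subseteq> K" "compact K"
  shows "compact_operator T"
proof -
  have "closure (T ` cball 0 1) \<subseteq> K"
    using assms(2,3) by (simp add: closure_minimal compact_imp_closed)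
  then have "compact (closure (T ` cball 0 1))"
    using compact_Int_closed[OF assms(3) closed_closure, of "T ` cball 0 1"]
    by (simp add: Int_absorb1)
  then show ?thesis using assms(1) by (simp add: compact_operator_def)
qed

text \<open>This is the usual argument that \<open>T\<close> is compact if \<open>T\<^sup>*T\<close> is, with
  \<open>\<parallel>T x\<parallel>\<^sup>2 \<le> \<parallel>x\<parallel> \<parallel>T\<^sup>*T x\<parallel>\<close>: points whose images under \<open>S\<close> are close have close images under \<open>T\<close>.\<close>

lemma compact_operator_if_square_dominated:
  fixes T S :: "'a::complex_hilbert_space \<Rightarrow> 'a"
  assumes T: "bounded_clinear T" and S: "bounded_linear S"
    and K: "compact K" "S ` cball 0 1 \<subseteq> K"
    and dom: "\<And>x. (norm (T x))\<^sup>2 \<le> C * norm x * norm (S x)"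
  shows "compact_operator T"
proof -
  interpret T: bounded_linear T by (rule bounded_clinear_bounded_linear[OF T])
  interpret S: bounded_linear S by (rule S)
  have "\<exists>k. finite k \<and> closure (T ` cball 0 1) \<subseteq> (\<Union>x\<in>k. ball x e)" if e: "e > 0" for e :: real
  proof -
    \<comment> \<open>Two points of the unit ball are at distance at most \<open>2\<close>, and their images under \<open>S\<close> will be at
      distance at most \<open>2\<delta>\<close>, which bounds the squared distance under \<open>T\<close> by \<open>(|C| + 1) \<sqdot> 2 \<sqdot> 2\<delta>\<close>.\<close>
    define \<delta> where "\<delta> = (e/2)\<^sup>2 / (4 * (\<bar>C\<bar> + 1))"
    have \<delta>: "\<delta> > 0" using e by (simp add: \<delta>_def add_nonneg_pos)
    obtain F where F: "finite F" "K \<subseteq> (\<Union>x\<in>F. ball x \<delta>)"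
      using K(1) \<delta> unfolding compact_eq_totally_bounded by blast
    define pick where "pick c = (SOME x. x \<in> cball 0 1 \<and> S x \<in> ball c \<delta>)" for c
    have "closure (T ` cball 0 1) \<subseteq> (\<Union>c\<in>F. cball (T (pick c)) (e/2))"
    proof (rule closure_minimal)
      show "closed (\<Union>c\<in>F. cball (T (pick c)) (e/2))"
        using F(1) by (intro closed_UN) auto
      show "T ` cball 0 1 \<subseteq> (\<Union>c\<in>F. cball (T (pick c)) (e/2))"
      proof clarify
        fix x :: 'a assume x: "x \<in> cball 0 1"
        then obtain c where c: "c \<in> F" "S x \<in> ball c \<delta>" using K(2) F(2) by blast
        then have p: "pick c \<in> cball 0 1" "S (pick c) \<in> ball c \<delta>"
          using someI[of "\<lambda>x. x \<in> cball 0 1 \<and> S x \<in> ball c \<delta>" x] x by (auto simp: pick_def)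
        let ?d = "x - pick c"
        have d: "norm ?d \<le> 2" using x p(1) norm_triangle_ineq4[of x "pick c"] by simp
        have "dist (S x) (S (pick c)) < \<delta> + \<delta>"
          using c(2) p(2) dist_triangle_less_add by (metis dist_commute mem_ball)
        then have Sd: "norm (S ?d) \<le> 2 * \<delta>" by (simp add: S.diff dist_norm)
        have "(norm (T ?d))\<^sup>2 \<le> C * norm ?d * norm (S ?d)" by (rule dom)
        also have "\<dots> \<le> (\<bar>C\<bar> + 1) * (norm ?d * norm (S ?d))"
          unfolding mult.assoc by (intro mult_right_mono) auto
        also have "\<dots> \<le> (\<bar>C\<bar> + 1) * (2 * (2 * \<delta>))"
          by (intro mult_left_mono mult_mono d Sd) auto
        also have "\<dots> = (e/2)\<^sup>2"
          by (simp add: \<delta>_def) (simp add: field_simps add_nonneg_eq_0_iff)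
        finally have "norm (T ?d) \<le> e/2" using e by (simp add: power2_le_iff_abs_le)
        then have "T x \<in> cball (T (pick c)) (e/2)" by (simp add: T.diff dist_norm norm_minus_commute)
        then show "T x \<in> (\<Union>c\<in>F. cball (T (pick c)) (e/2))" using c(1) by blast
      qed
    qed
    also have "\<dots> \<subseteq> (\<Union>x\<in>(\<lambda>c. T (pick c)) ` F. ball x e)" using e by auto
    finally show ?thesis using F(1) by (intro exI[of _ "(\<lambda>c. T (pick c)) ` F"]) simp
  qed
  moreover have "complete (closure (T ` cball 0 1))" by (simp add: complete_eq_closed)
  ultimately have "compact (closure (T ` cball 0 1))"
    unfolding compact_eq_totally_bounded by (intro conjI allI impI)
  then show ?thesis using T by (simp add: compact_operator_def)
qed

text \<open>Write \<open>R = (1 + D\<^sup>*D)\<^sup>-\<^sup>1\<^sup>/\<^sup>2\<close> and \<open>R' = (1 + DD\<^sup>*)\<^sup>-\<^sup>1\<^sup>/\<^sup>2\<close>.  Since \<open>D\<^sup>*R'\<close> is a contraction and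
  \<open>a\<close> maps \<open>dom(D\<^sup>*)\<close> to \<open>dom(D)\<close> with bounded commutator, \<open>a R'\<close> maps the unit ball into a ball of
  \<open>dom(D)\<close> for the graph norm.  There \<open>a\<^sup>*\<close> is compact because \<open>a\<^sup>*R\<close> is, so \<open>a\<^sup>*a R'\<close> is compact, and
  \<open>\<parallel>a R'x\<parallel>\<^sup>2 \<le> \<parallel>R'x\<parallel> \<parallel>a\<^sup>*a R'x\<parallel>\<close>.\<close>

lemma compact_operator_inverse_sqrt_adjoint:
  assumes D: "closed_operator D" "symmetric_operator D"
    and a: "bounded_clinear a" and a_dom: "a ` Domain (D\<^sup>\<star>) \<subseteq> Domain D"
    and ext: "bounded_extension (commutator (D\<^sup>\<star>) a) T"
    and ad: "bounded_clinear (cadjoint a)"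
    and cpt: "compact_operator (cadjoint a \<circ> inverse_sqrt_one_plus D)"
  shows "compact_operator (a \<circ> inverse_sqrt_one_plus (D\<^sup>\<star>))"
proof -
  note D' = closed_operatorD[OF D(1)]
  let ?R = "inverse_sqrt_one_plus D" and ?R' = "inverse_sqrt_one_plus (D\<^sup>\<star>)"
  have sub: "D \<subseteq> D\<^sup>\<star>" using D(2) by (simp add: symmetric_operator_def)
  have "densely_defined (D\<^sup>\<star>)"
    using D'(3) closure_mono[OF Domain_mono[OF sub]] by (auto simp: densely_defined_def)
  then have Ds: "closed_operator (D\<^sup>\<star>)"
    by (simp add: closed_operator_def linear_operator_def csubspace_op_adjoint closed_op_adjoint
        single_valued_op_adjoint[OF D'(3)])
  have T: "bounded_clinear T" and T_eq: "\<And>x y. (x, y) \<in> commutator (D\<^sup>\<star>) a \<Longrightarrow> T x = y"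
    using ext by (auto simp: bounded_extension_def)
  have R': "bounded_clinear ?R'"
    by (rule bounded_clinear_one_plus_neg_power[OF csubspace_op_adjoint closed_op_adjoint]) simp
  note bl = bounded_clinear_bounded_linear
  \<comment> \<open>The first summand bounds \<open>a R'x\<close>, the bracket bounds \<open>D a R'x = \<partial>(a) R'x + a D\<^sup>*R'x\<close>; the last
      \<open>1\<close> makes the rescaled vector lie strictly inside the unit ball.\<close>
  define C where "C = onorm a * onorm ?R' + (onorm T * onorm ?R' + onorm a) + 1"
  have C: "C > 0" unfolding C_def
    by (intro add_nonneg_pos add_nonneg_nonneg mult_nonneg_nonneg onorm_pos_le bl a R' T) simp
  let ?K = "closure ((cadjoint a \<circ> ?R) ` cball 0 1)"
  show ?thesis
  proof (rule compact_operator_if_square_dominated)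
    show "bounded_clinear (a \<circ> ?R')" unfolding comp_def by (rule bounded_clinear_compose[OF a R'])
    show "bounded_linear (\<lambda>x. cadjoint a (a (?R' x)))"
      by (intro bl bounded_clinear_compose[OF ad] bounded_clinear_compose[OF a R'])
    show "compact ((\<lambda>x. C *\<^sub>R x) ` ?K)"
      using cpt by (intro compact_scaling) (simp add: compact_operator_def)
    show "(norm ((a \<circ> ?R') x))\<^sup>2 \<le> onorm ?R' * norm x * norm (cadjoint a (a (?R' x)))" for x
    proof -
      have "complex_of_real ((norm (a (?R' x)))\<^sup>2) = cinner (cadjoint a (a (?R' x))) (?R' x)"
        by (simp add: cinner_cadjoint[OF a] cinner_self)
      then have "(norm (a (?R' x)))\<^sup>2 = cmod (cinner (cadjoint a (a (?R' x))) (?R' x))"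
        by (metis abs_of_nonneg norm_of_real zero_le_power2)
      also have "\<dots> \<le> norm (cadjoint a (a (?R' x))) * norm (?R' x)" by (rule norm_cinner_le)
      also have "\<dots> \<le> norm (cadjoint a (a (?R' x))) * (onorm ?R' * norm x)"
        by (intro mult_left_mono onorm[OF bl[OF R']]) simp
      finally show ?thesis by (simp add: mult_ac)
    qed
    show "(\<lambda>x. cadjoint a (a (?R' x))) ` cball 0 1 \<subseteq> (\<lambda>x. C *\<^sub>R x) ` ?K"
    proof clarify
      fix x :: 'a assume x: "x \<in> cball 0 1"
      obtain w where w: "(?R' x, w) \<in> D\<^sup>\<star>" "norm w \<le> norm x"
        using inverse_sqrt_one_plus_graph[OF Ds] by blast
      obtain v where v: "(a (?R' x), v) \<in> D" using a_dom w(1) by blast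
      have "(?R' x, v - a w) \<in> commutator (D\<^sup>\<star>) a"
        using w(1) v sub by (auto simp: commutator_def)
      then have v_eq: "v = T (?R' x) + a w" using T_eq by fastforce
      have R'x: "norm (?R' x) \<le> onorm ?R'"
        using onorm[OF bl[OF R'], of x] x onorm_pos_le[OF bl[OF R']]
        by (simp add: mult_left_le order_trans)
      have "norm w \<le> 1" using w(2) x by simp
      have "norm (a (?R' x)) \<le> onorm a * onorm ?R'"
        using onorm[OF bl[OF a], of "?R' x"] mult_left_mono[OF R'x onorm_pos_le[OF bl[OF a]]] by simp
      moreover have "norm (T (?R' x)) \<le> onorm T * onorm ?R'"
        using onorm[OF bl[OF T], of "?R' x"] mult_left_mono[OF R'x onorm_pos_le[OF bl[OF T]]] by simp
      moreover have "norm (a w) \<le> onorm a"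
        using onorm[OF bl[OF a], of w] mult_left_mono[OF \<open>norm w \<le> 1\<close> onorm_pos_le[OF bl[OF a]]] by simp
      moreover have "norm v \<le> norm (T (?R' x)) + norm (a w)"
        unfolding v_eq by (rule norm_triangle_ineq)
      moreover have "norm (a (?R' x), v) \<le> norm (a (?R' x)) + norm v"
        by (simp add: norm_Pair sqrt_sum_squares_le_sum)
      ultimately have "norm (a (?R' x), v) < C" by (simp add: C_def)
      moreover have "((1/C) *\<^sub>R a (?R' x), (1/C) *\<^sub>R v) = (1/C) *\<^sub>R (a (?R' x), v)" by simp
      ultimately have lt: "norm ((1/C) *\<^sub>R a (?R' x), (1/C) *\<^sub>R v) < 1"
        using C by (simp only: norm_scaleR) (simp add: field_simps)
      have "((1/C) *\<^sub>R a (?R' x), (1/C) *\<^sub>R v) \<in> D"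
        using complex_vector.subspace_scale[OF D'(1) v, of "complex_of_real (1/C)"]
        by (simp add: scaleC_prod_def scaleC_of_real del: of_real_divide)
      then have "cadjoint a ((1/C) *\<^sub>R a (?R' x)) \<in> ?K"
        using image_graph_ball_subset_closure[OF D(1) ad _ lt] by blast
      moreover have "cadjoint a (a (?R' x)) = C *\<^sub>R cadjoint a ((1/C) *\<^sub>R a (?R' x))"
        using C linear_simps(5)[OF bl[OF ad]] by simp
      ultimately show "cadjoint a (a (?R' x)) \<in> (\<lambda>x. C *\<^sub>R x) ` ?K" by blast
    qed
  qed
qed

section \<open>Block operators and singular values\<close>

text \<open>The operator \<open>(x, y) \<mapsto> (S x + T y) / 2\<close> in both components; for \<open>S = a B\<close> and \<open>T = a C\<close>
  this is \<open>(a \<otimes> q)\<close> composed with the diagonal operator with blocks \<open>B\<close> and \<open>C\<close>.\<close>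

definition averaging_block ::
    "('h::complex_hilbert_space \<Rightarrow> 'h) \<Rightarrow> ('h \<Rightarrow> 'h) \<Rightarrow> ('h \<times> 'h \<Rightarrow> 'h \<times> 'h)" where
  "averaging_block S T = (\<lambda>p. ((1/2) *\<^sub>C (S (fst p) + T (snd p)), (1/2) *\<^sub>C (S (fst p) + T (snd p))))"

lemma bounded_clinear_averaging_block:
  assumes "bounded_clinear S" "bounded_clinear T"
  shows "bounded_clinear (averaging_block S T)"
  unfolding averaging_block_def
  by (intro bounded_clinear_Pair bounded_clinear_compose[OF bounded_clinear_const_scaleC]
      bounded_clinear_add bounded_clinear_compose[OF assms(1) bounded_clinear_fst]
      bounded_clinear_compose[OF assms(2) bounded_clinear_snd])

lemma compact_operator_averaging_block:
  assumes S: "compact_operator S" and T: "compact_operator T"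
  shows "compact_operator (averaging_block S T)"
proof (rule compact_operatorI)
  let ?KS = "closure (S ` cball 0 1)" and ?KT = "closure (T ` cball 0 1)"
  let ?f = "\<lambda>u. ((1/2) *\<^sub>C u, (1/2) *\<^sub>C u)"
  let ?K = "?f ` {u + v |u v. u \<in> ?KS \<and> v \<in> ?KT}"
  show "bounded_clinear (averaging_block S T)"
    using S T by (simp add: bounded_clinear_averaging_block compact_operator_def)
  show "compact ?K"
    using S T
    by (intro compact_continuous_image compact_sums continuous_on_Pair
        linear_continuous_on bounded_linear_scaleC) (auto simp: compact_operator_def)
  show "averaging_block S T ` cball 0 1 \<subseteq> ?K"
  proof (rule image_subsetI)
    fix p :: "'a \<times> 'a" assume "p \<in> cball 0 1"
    then have "norm (fst p) \<le> 1" "norm (snd p) \<le> 1"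
      using norm_fst_le[of "fst p" "snd p"] norm_snd_le[of "snd p" "fst p"] by simp_all
    then have "S (fst p) \<in> ?KS" "T (snd p) \<in> ?KT"
      using closure_subset[of "S ` cball 0 1"] closure_subset[of "T ` cball 0 1"] by auto
    then show "averaging_block S T p \<in> ?K"
      unfolding averaging_block_def by (intro imageI) blast
  qed
qed

definition finite_rank :: "nat \<Rightarrow> ('a::complex_hilbert_space \<Rightarrow> 'a) \<Rightarrow> bool" where
  "finite_rank n R \<longleftrightarrow> bounded_clinear R \<and> (\<exists>B. finite B \<and> card B \<le> n \<and> range R \<subseteq> cspan B)"

lemma singular_value_eq:
  "singular_value n T = Inf {onorm (\<lambda>x. T x - R x) |R. finite_rank n R}"
  by (simp add: singular_value_def finite_rank_def)

lemma singular_value_le: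
  assumes "bounded_clinear T" "finite_rank n R"
  shows "singular_value n T \<le> onorm (\<lambda>x. T x - R x)"
  unfolding singular_value_eq
proof (rule cInf_lower)
  show "bdd_below {onorm (\<lambda>x. T x - R x) |R. finite_rank n R}"
    by (rule bdd_belowI[of _ 0])
      (auto simp: finite_rank_def intro!: onorm_pos_le bounded_clinear_bounded_linear bounded_clinear_sub assms(1))
qed (intro CollectI exI[of _ R] conjI refl assms(2))

lemma finite_rank_zero: "finite_rank n (\<lambda>x. 0)"
  unfolding finite_rank_def
  by (auto simp: bounded_clinear_zero intro!: exI[of _ "{}"] complex_vector.span_zero)

lemma singular_value_nonneg:
  assumes "bounded_clinear T" shows "0 \<le> singular_value n T"
  unfolding singular_value_eq
proof (rule cInf_greatest)
  show "{onorm (\<lambda>x. T x - R x) |R. finite_rank n R} \<noteq> {}" using finite_rank_zero by blast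
qed (auto simp: finite_rank_def intro!: onorm_pos_le bounded_clinear_bounded_linear bounded_clinear_sub assms)

lemma singular_value_approx:
  assumes "e > 0"
  obtains R where "finite_rank n R" "onorm (\<lambda>x. T x - R x) < singular_value n T + e"
proof -
  have "{onorm (\<lambda>x. T x - R x) |R. finite_rank n R} \<noteq> {}" using finite_rank_zero by blast
  moreover have "Inf {onorm (\<lambda>x. T x - R x) |R. finite_rank n R} < singular_value n T + e"
    using assms by (simp add: singular_value_eq)
  ultimately have "\<exists>r\<in>{onorm (\<lambda>x. T x - R x) |R. finite_rank n R}. r < singular_value n T + e"
    by (rule cInf_lessD)
  then show thesis using that by auto
qed

lemma finite_rank_averaging_block:
  assumes S: "finite_rank n S" and T: "finite_rank n T" and m: "2 * n \<le> m"
  shows "finite_rank m (averaging_block S T)"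
proof -
  obtain B C where B: "finite B" "card B \<le> n" "range S \<subseteq> cspan B"
    and C: "finite C" "card C \<le> n" "range T \<subseteq> cspan C"
    using S T by (auto simp: finite_rank_def)
  let ?J = "\<lambda>u. (u, u)"
  have in_span: "(u, u) \<in> cspan (?J ` E)" if "u \<in> cspan E" for u :: 'a and E
    using that
  proof (induction rule: complex_vector.span_induct_alt)
    case base
    then show ?case using complex_vector.span_zero[of "?J ` E"] by (simp add: zero_prod_def)
  next
    case (step c x y)
    then have "c *\<^sub>C (x, x) + (y, y) \<in> cspan (?J ` E)"
      by (intro complex_vector.span_add[OF complex_vector.span_scale[OF complex_vector.span_base]]) auto
    then show ?case by (simp add: scaleC_prod_def)
  qed
  have "averaging_block S T p \<in> cspan (?J ` (B \<union> C))" for p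
  proof -
    have "S (fst p) \<in> cspan (B \<union> C)" "T (snd p) \<in> cspan (B \<union> C)"
      using B(3) C(3) complex_vector.span_mono[of B "B \<union> C"] complex_vector.span_mono[of C "B \<union> C"] by blast+
    then have "(1/2) *\<^sub>C (S (fst p) + T (snd p)) \<in> cspan (B \<union> C)"
      by (rule complex_vector.span_scale[OF complex_vector.span_add])
    then show ?thesis unfolding averaging_block_def by (rule in_span)
  qed
  then have "range (averaging_block S T) \<subseteq> cspan (?J ` (B \<union> C))" by blast
  moreover have fin: "finite (B \<union> C)" using B(1) C(1) by simp
  moreover have "card (?J ` (B \<union> C)) \<le> m"
    using card_image_le[OF fin, of ?J] card_Un_le[of B C] B(2) C(2) m by linarith
  moreover have "bounded_clinear (averaging_block S T)"
    using S T by (simp add: finite_rank_def bounded_clinear_averaging_block)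
  ultimately show ?thesis
    unfolding finite_rank_def by (intro conjI exI[of _ "?J ` (B \<union> C)"]) simp_all
qed

lemma norm_averaging_block_le:
  assumes "bounded_linear S" "bounded_linear T"
  shows "onorm (averaging_block S T) \<le> onorm S + onorm T"
proof (rule onorm_bound)
  fix p
  let ?u = "S (fst p) + T (snd p)"
  have S: "norm (S (fst p)) \<le> onorm S * norm p"
    using onorm[OF assms(1), of "fst p"] mult_left_mono[OF norm_fst_le[of "fst p" "snd p"] onorm_pos_le[OF assms(1)]] by simp
  have T: "norm (T (snd p)) \<le> onorm T * norm p"
    using onorm[OF assms(2), of "snd p"] mult_left_mono[OF norm_snd_le[of "snd p" "fst p"] onorm_pos_le[OF assms(2)]] by simp
  have "norm (averaging_block S T p) \<le> norm ((1/2) *\<^sub>C ?u) + norm ((1/2) *\<^sub>C ?u)"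
    unfolding averaging_block_def by (simp only: norm_Pair) (rule sqrt_sum_squares_le_sum; simp)
  also have "\<dots> = norm ?u" by (simp add: norm_scaleC)
  also have "\<dots> \<le> (onorm S + onorm T) * norm p"
    using norm_triangle_ineq[of "S (fst p)" "T (snd p)"] S T by (simp add: distrib_right)
  finally show "norm (averaging_block S T p) \<le> (onorm S + onorm T) * norm p" .
qed (intro add_nonneg_nonneg onorm_pos_le assms)

text \<open>The block of two approximants of rank at most \<open>n\<close> has rank at most \<open>2n\<close>, because its range lies
  in the diagonal copy of the sum of their ranges.\<close>

lemma singular_value_averaging_block_le:
  assumes S: "bounded_clinear S" and T: "bounded_clinear T" and m: "2 * n \<le> m"
  shows "singular_value m (averaging_block S T) \<le> singular_value n S + singular_value n T"
proof (rule field_le_epsilon)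
  fix e :: real assume "e > 0"
  then obtain P Q where P: "finite_rank n P" "onorm (\<lambda>x. S x - P x) < singular_value n S + e / 2"
    and Q: "finite_rank n Q" "onorm (\<lambda>x. T x - Q x) < singular_value n T + e / 2"
    using singular_value_approx[of "e / 2"] by (metis half_gt_zero)
  have P': "bounded_clinear P" and Q': "bounded_clinear Q" using P Q by (auto simp: finite_rank_def)
  have "singular_value m (averaging_block S T)
      \<le> onorm (\<lambda>p. averaging_block S T p - averaging_block P Q p)"
    by (rule singular_value_le[OF bounded_clinear_averaging_block[OF S T] finite_rank_averaging_block[OF P(1) Q(1) m]])
  also have "(\<lambda>p. averaging_block S T p - averaging_block P Q p)
      = averaging_block (\<lambda>x. S x - P x) (\<lambda>x. T x - Q x)"
    by (simp add: fun_eq_iff averaging_block_def flip: complex_vector.scale_right_diff_distrib)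
  also have "onorm \<dots> \<le> onorm (\<lambda>x. S x - P x) + onorm (\<lambda>x. T x - Q x)"
    by (intro norm_averaging_block_le bounded_clinear_bounded_linear bounded_clinear_sub S T P' Q')
  finally show "singular_value m (averaging_block S T) \<le> singular_value n S + singular_value n T + e"
    using P(2) Q(2) by simp
qed

text \<open>Passing from the index \<open>m\<close> to \<open>m div 2\<close> costs a factor of at most \<open>2\<close> in \<open>1/(m + 1)\<close>.\<close>

lemma weak_trace_ideal_averaging_block:
  assumes S: "S \<in> \<L>\<^sub>1\<^sub>\<infinity>" and T: "T \<in> \<L>\<^sub>1\<^sub>\<infinity>"
  shows "averaging_block S T \<in> \<L>\<^sub>1\<^sub>\<infinity>"
proof -
  have cpt: "compact_operator S" "compact_operator T" using S T by (auto simp: weak_trace_ideal_def)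
  then have bc: "bounded_clinear S" "bounded_clinear T" by (auto simp: compact_operator_def)
  have "(\<lambda>n. singular_value n S + singular_value n T) \<in> O(\<lambda>n. 1 / (real n + 1))"
    using S T by (intro sum_in_bigo) (auto simp: weak_trace_ideal_def)
  then obtain c where "c > 0" and c: "\<forall>\<^sub>F n in sequentially.
      norm (singular_value n S + singular_value n T) \<le> c * norm (1 / (real n + 1))"
    by (rule landau_o.bigE)
  then obtain N where N: "\<And>n. n \<ge> N \<Longrightarrow>
      norm (singular_value n S + singular_value n T) \<le> c * norm (1 / (real n + 1))"
    unfolding eventually_sequentially by blast
  have "(\<lambda>m. singular_value m (averaging_block S T)) \<in> O(\<lambda>n. 1 / (real n + 1))"
  proof (rule landau_o.bigI)
    show "2 * c > 0" using \<open>c > 0\<close> by simp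
    show "\<forall>\<^sub>F m in sequentially. norm (singular_value m (averaging_block S T)) \<le> 2 * c * norm (1 / (real m + 1))"
      unfolding eventually_sequentially
    proof (intro exI[of _ "2 * N"] allI impI)
      fix m assume m: "2 * N \<le> m"
      let ?n = "m div 2"
      have "norm (singular_value m (averaging_block S T)) = singular_value m (averaging_block S T)"
        using singular_value_nonneg[OF bounded_clinear_averaging_block[OF bc]] by simp
      also have "\<dots> \<le> singular_value ?n S + singular_value ?n T"
        by (rule singular_value_averaging_block_le[OF bc]) simp
      also have "\<dots> \<le> c * (1 / (real ?n + 1))" using N[of ?n] m by (simp add: less_eq_div_iff_mult_less_eq mult.commute abs_le_iff)
      also have "\<dots> \<le> c * (2 * (1 / (real m + 1)))"
      proof (rule mult_left_mono)
        have "m + 1 \<le> 2 * (m div 2 + 1)" by simp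
        then have "real (m + 1) \<le> real (2 * (m div 2 + 1))" by (simp only: of_nat_le_iff)
        then show "1 / (real ?n + 1) \<le> 2 * (1 / (real m + 1))" by (simp add: field_simps)
      qed (use \<open>c > 0\<close> in simp)
      also have "\<dots> = 2 * c * norm (1 / (real m + 1))" by simp
      finally show "norm (singular_value m (averaging_block S T)) \<le> 2 * c * norm (1 / (real m + 1))" .
    qed
  qed
  then show ?thesis
    using compact_operator_averaging_block[OF cpt] by (simp add: weak_trace_ideal_def)
qed

section \<open>The clone\<close>

lemma clone_operator_iff:
  "((x, y), (v, w)) \<in> clone_operator D \<longleftrightarrow> (y, v) \<in> D\<^sup>\<star> \<and> (x, w) \<in> D"
  by (auto simp: clone_operator_def)

lemma tensor_clone_q: "a \<otimes>\<^sub>2 clone_q = averaging_block a a"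
  by (simp add: tensor_matrix_def clone_q_def averaging_block_def fun_eq_iff scaleC_add_right)

lemma tensor_mat_1: "a \<otimes>\<^sub>2 mat 1 = (\<lambda>p. (a (fst p), a (snd p)))"
  by (simp add: tensor_matrix_def mat_def fun_eq_iff)

lemma clone_algebra_eq: "clone_algebra A = (\<lambda>a. averaging_block a a) ` A"
  by (auto simp: clone_algebra_def tensor_clone_q)

text \<open>The projection \<open>q\<close> is self-adjoint, so \<open>(a \<otimes> q)\<^sup>* = a\<^sup>* \<otimes> q\<close>.\<close>

lemma cadjoint_averaging_block:
  assumes "bounded_clinear a"
  shows "cadjoint (averaging_block a a) = averaging_block (cadjoint a) (cadjoint a)"
  by (rule cadjoint_eqI)
    (simp add: averaging_block_def cinner_prod_def cinner_scaleC_left cinner_scaleC_right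
      cinner_add_left cinner_add_right cinner_cadjoint[OF assms] algebra_simps)

lemma star_subalgebra_clone_algebra:
  assumes A: "star_subalgebra A"
  shows "star_subalgebra (clone_algebra A)"
proof -
  have bc: "bounded_clinear a" if "a \<in> A" for a using A that by (auto simp: star_subalgebra_def)
  note bl = bounded_clinear_bounded_linear[OF bc]
  have block: "averaging_block a a \<in> clone_algebra A" if "a \<in> A" for a
    using that by (auto simp: clone_algebra_eq)
  have "(\<lambda>x. 0) \<in> clone_algebra A"
  proof -
    have zero_eq: "(\<lambda>x. 0) = averaging_block (\<lambda>x. 0) (\<lambda>x. 0)"
      by (simp add: averaging_block_def fun_eq_iff zero_prod_def)
    show ?thesis unfolding zero_eq by (rule block) (use A in \<open>simp add: star_subalgebra_def\<close>)
  qed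
  moreover have "(\<lambda>p. averaging_block a a p + averaging_block b b p) \<in> clone_algebra A"
    if "a \<in> A" "b \<in> A" for a b
  proof -
    have "(\<lambda>p. averaging_block a a p + averaging_block b b p)
        = averaging_block (\<lambda>x. a x + b x) (\<lambda>x. a x + b x)"
      by (simp add: averaging_block_def fun_eq_iff scaleC_add_right)
    moreover have "(\<lambda>x. a x + b x) \<in> A" using A that by (simp add: star_subalgebra_def)
    ultimately show ?thesis using block by metis
  qed
  moreover have "(\<lambda>p. c *\<^sub>C averaging_block a a p) \<in> clone_algebra A" if "a \<in> A" for c a
  proof -
    have "(\<lambda>p. c *\<^sub>C averaging_block a a p) = averaging_block (\<lambda>x. c *\<^sub>C a x) (\<lambda>x. c *\<^sub>C a x)"
      by (simp add: averaging_block_def fun_eq_iff scaleC_prod_def scaleC_add_right scaleC_scaleC mult.commute)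
    moreover have "(\<lambda>x. c *\<^sub>C a x) \<in> A" using A that by (simp add: star_subalgebra_def)
    ultimately show ?thesis using block by metis
  qed
  moreover have "averaging_block a a \<circ> averaging_block b b \<in> clone_algebra A"
    if "a \<in> A" "b \<in> A" for a b
  proof -
    have "(1/2) *\<^sub>C (u + u) = u" for u :: 'a
      by (simp add: scaleC_add_right flip: scaleC_add_left)
    then have "averaging_block a a \<circ> averaging_block b b = averaging_block (a \<circ> b) (a \<circ> b)"
      by (simp add: averaging_block_def fun_eq_iff bounded_clinear_scaleC[OF bc[OF that(1)]]
          linear_simps(1)[OF bl[OF that(1)]] flip: scaleC_add_right)
    moreover have "a \<circ> b \<in> A" using A that by (simp add: star_subalgebra_def)
    ultimately show ?thesis using block by metis
  qed
  moreover have "cadjoint (averaging_block a a) \<in> clone_algebra A" if "a \<in> A" for a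
  proof -
    have "cadjoint a \<in> A" using A that by (simp add: star_subalgebra_def)
    then show ?thesis using block by (simp add: cadjoint_averaging_block[OF bc[OF that]])
  qed
  ultimately show ?thesis
    unfolding star_subalgebra_def
    by (auto simp: clone_algebra_eq bc bounded_clinear_averaging_block)
qed

text \<open>Elements \<open>((x, 0), (0, D x))\<close> and \<open>((0, y), (D\<^sup>*y, 0))\<close> of the graph of \<open>D\<^sub>2\<close> separate the two
  conditions for membership in the adjoint; one of them defines \<open>D\<^sup>*\<close>, the other \<open>D\<^sup>*\<^sup>* = D\<close>.\<close>

lemma op_adjoint_clone_operator:
  assumes D: "csubspace D" "closed D"
  shows "(clone_operator D)\<^sup>\<star> = clone_operator D"
proof
  have D_iff: "(x, w) \<in> D \<longleftrightarrow> (\<forall>y v. (y, v) \<in> D\<^sup>\<star> \<longrightarrow> cinner x v = cinner w y)" for x w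
    using op_adjoint_iff[of x w "D\<^sup>\<star>"] op_adjoint_op_adjoint[OF D] by simp
  have 0: "(0, 0) \<in> D" "(0, 0) \<in> D\<^sup>\<star>"
    using complex_vector.subspace_0[OF D(1)] complex_vector.subspace_0[OF csubspace_op_adjoint[of D]]
    by (simp_all add: zero_prod_def)
  show "clone_operator D \<subseteq> (clone_operator D)\<^sup>\<star>"
  proof clarify
    fix a b c d assume abcd: "((a, b), (c, d)) \<in> clone_operator D"
    then have 1: "(b, c) \<in> D\<^sup>\<star>" "(a, d) \<in> D" by (simp_all add: clone_operator_iff)
    show "((a, b), (c, d)) \<in> (clone_operator D)\<^sup>\<star>"
      unfolding op_adjoint_iff
    proof (intro allI impI)
      fix p q assume "(p, q) \<in> clone_operator D"
      then obtain x y v w where pq: "p = (x, y)" "q = (v, w)" "(y, v) \<in> D\<^sup>\<star>" "(x, w) \<in> D"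
        by (auto simp: clone_operator_def)
      have "cinner a v = cinner d y" using 1(2) pq(3) D_iff by blast
      moreover have "cinner b w = cinner c x" by (rule op_adjoint_cinner[OF 1(1) pq(4)])
      ultimately show "cinner (a, b) q = cinner (c, d) p"
        by (simp add: cinner_prod_def pq)
    qed
  qed
  show "(clone_operator D)\<^sup>\<star> \<subseteq> clone_operator D"
  proof clarify
    fix a b c d assume "((a, b), (c, d)) \<in> (clone_operator D)\<^sup>\<star>"
    then have eq: "cinner a v + cinner b w = cinner c x + cinner d y"
      if "(y, v) \<in> D\<^sup>\<star>" "(x, w) \<in> D" for x y v w
      using that op_adjoint_cinner[of "(a, b)" "(c, d)" "clone_operator D" "(x, y)" "(v, w)"]
      by (simp add: clone_operator_iff cinner_prod_def)
    have "(a, d) \<in> D"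
      unfolding D_iff using eq[OF _ 0(1)] by (simp add: cinner.zero_right)
    moreover have "(b, c) \<in> D\<^sup>\<star>"
      unfolding op_adjoint_iff using eq[OF 0(2)] by (simp add: cinner.zero_right)
    ultimately show "((a, b), (c, d)) \<in> clone_operator D" by (simp add: clone_operator_iff)
  qed
qed

lemma densely_defined_op_adjoint:
  "densely_defined D \<Longrightarrow> symmetric_operator D \<Longrightarrow> densely_defined (D\<^sup>\<star>)"
  using closure_mono[OF Domain_mono, of D "D\<^sup>\<star>"]
  by (auto simp: densely_defined_def symmetric_operator_def)

lemma selfadjoint_clone_operator:
  assumes D: "closed_operator D" "symmetric_operator D"
  shows "selfadjoint_operator (clone_operator D)"
proof -
  note D' = closed_operatorD[OF D(1)]
  note adj = op_adjoint_clone_operator[OF D'(1,4)]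
  have "Domain (clone_operator D) = Domain D \<times> Domain (D\<^sup>\<star>)"
    by (auto simp: Domain_iff clone_operator_iff)
  then have dense: "densely_defined (clone_operator D)"
    using D'(3) densely_defined_op_adjoint[OF D'(3) D(2)]
    by (simp add: densely_defined_def closure_Times)
  have "single_valued (clone_operator D)" "csubspace (clone_operator D)"
    using single_valued_op_adjoint[OF dense] csubspace_op_adjoint[of "clone_operator D"]
    by (simp_all add: adj)
  then show ?thesis
    using dense adj by (simp add: selfadjoint_operator_def linear_operator_def)
qed

text \<open>\<open>D\<^sub>2\<^sup>2\<close> is the diagonal operator with blocks \<open>D\<^sup>*D\<close> and \<open>D\<^sup>*\<^sup>*D\<^sup>* = DD\<^sup>*\<close>.\<close>

lemma inverse_one_plus_clone_operator:
  assumes D: "closed_operator D" "symmetric_operator D"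
  shows "inverse_one_plus (abs_square (clone_operator D))
    = (\<lambda>(x, y). (inverse_one_plus (abs_square D) x, inverse_one_plus (abs_square (D\<^sup>\<star>)) y))"
proof
  note D' = closed_operatorD(1,4)[OF D(1)]
  note adj = op_adjoint_clone_operator[OF D']
  have C: "csubspace (clone_operator D)"
    using csubspace_op_adjoint[of "clone_operator D"] by (simp add: adj)
  fix p :: "'a \<times> 'a"
  obtain x y where p: "p = (x, y)" by fastforce
  let ?x = "inverse_one_plus (D O D\<^sup>\<star>) x" and ?y = "inverse_one_plus (D\<^sup>\<star> O (D\<^sup>\<star>)\<^sup>\<star>) y"
  obtain z where z: "(?x, z) \<in> D" "(z, x - ?x) \<in> D\<^sup>\<star>" by (rule inverse_one_plus_graph[OF D'])
  obtain w where w: "(?y, w) \<in> D\<^sup>\<star>" "(w, y - ?y) \<in> (D\<^sup>\<star>)\<^sup>\<star>"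
    by (rule inverse_one_plus_graph[OF csubspace_op_adjoint closed_op_adjoint])
  have "inverse_one_plus (clone_operator D O (clone_operator D)\<^sup>\<star>) (x, y) = (?x, ?y)"
  proof (rule inverse_one_plus_eqI[OF C])
    show "((?x, ?y), (w, z)) \<in> clone_operator D"
      using z w by (simp add: clone_operator_iff)
    show "((w, z), (x, y) - (?x, ?y)) \<in> (clone_operator D)\<^sup>\<star>"
      using z w by (simp add: adj clone_operator_iff op_adjoint_op_adjoint[OF D'])
  qed
  then show "inverse_one_plus (abs_square (clone_operator D)) p
      = (case p of (x, y) \<Rightarrow> (inverse_one_plus (abs_square D) x, inverse_one_plus (abs_square (D\<^sup>\<star>)) y))"
    by (simp add: p abs_square_def)
qed

lemma one_plus_neg_power_clone_operator:
  assumes D: "closed_operator D" "symmetric_operator D" and s: "s > 0"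
  shows "one_plus_neg_power (abs_square (clone_operator D)) s
    = (\<lambda>(x, y). (one_plus_neg_power (abs_square D) s x, one_plus_neg_power (abs_square (D\<^sup>\<star>)) s y))"
  unfolding one_plus_neg_power_def inverse_one_plus_clone_operator[OF D]
proof (rule functional_calculus_diagonal)
  show "positive_operator (inverse_one_plus (abs_square D))"
    unfolding abs_square_def
    by (rule positive_operator_inverse_one_plus[OF closed_operatorD(1,4)[OF D(1)]])
  show "positive_operator (inverse_one_plus (abs_square (D\<^sup>\<star>)))"
    unfolding abs_square_def
    by (rule positive_operator_inverse_one_plus[OF csubspace_op_adjoint closed_op_adjoint])
qed (rule continuous_on_powr_const[OF s])

lemma averaging_block_comp_clone_power:
  assumes D: "closed_operator D" "symmetric_operator D" and s: "s > 0"
  shows "averaging_block a a \<circ> one_plus_neg_power (abs_square (clone_operator D)) s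
    = averaging_block (a \<circ> one_plus_neg_power (abs_square D) s)
        (a \<circ> one_plus_neg_power (abs_square (D\<^sup>\<star>)) s)"
  unfolding one_plus_neg_power_clone_operator[OF assms]
  by (simp add: fun_eq_iff averaging_block_def)

text \<open>On \<open>p = (x, y)\<close> the operator \<open>a \<otimes> q\<close> depends only on \<open>m = (x + y)/2\<close>.  Because \<open>D\<^sup>*\<close> extends \<open>D\<close>,
  both components of \<open>D\<^sub>2 (a \<otimes> q) p\<close> equal \<open>D\<^sup>*a m\<close>, and averaging \<open>D\<^sub>2 p = (D\<^sup>*y, D x)\<close> gives \<open>D\<^sup>*m\<close>.\<close>

lemma bounded_extension_clone_commutator:
  assumes D: "closed_operator D" "symmetric_operator D"
    and a: "bounded_clinear a" and ext: "bounded_extension (commutator (D\<^sup>\<star>) a) T"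
  shows "bounded_extension (commutator (clone_operator D) (averaging_block a a)) (averaging_block T T)"
proof -
  have sub: "D \<subseteq> D\<^sup>\<star>" using D(2) by (simp add: symmetric_operator_def)
  have T: "bounded_clinear T" and T_eq: "\<And>x y. (x, y) \<in> commutator (D\<^sup>\<star>) a \<Longrightarrow> T x = y"
    using ext by (auto simp: bounded_extension_def)
  have block_eq: "averaging_block S S (x, y) = (S ((1/2) *\<^sub>C (x + y)), S ((1/2) *\<^sub>C (x + y)))"
    if "bounded_clinear S" for S :: "'a \<Rightarrow> 'a" and x y
    using linear_simps(1)[OF bounded_clinear_bounded_linear[OF that]]
    by (simp add: averaging_block_def bounded_clinear_scaleC[OF that])
  have "averaging_block T T p = q"
    if pq: "(p, q) \<in> commutator (clone_operator D) (averaging_block a a)" for p q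
  proof -
    obtain u v where u: "(p, u) \<in> clone_operator D"
      and v: "(averaging_block a a p, v) \<in> clone_operator D" and q: "q = v - averaging_block a a u"
      using pq unfolding commutator_def by blast
    obtain x y u1 u2 v1 v2 where p: "p = (x, y)" "u = (u1, u2)" "v = (v1, v2)" by (metis surj_pair)
    let ?m = "(1/2) *\<^sub>C (x + y)" and ?n = "(1/2) *\<^sub>C (u1 + u2)"
    have "(y, u1) \<in> D\<^sup>\<star>" "(x, u2) \<in> D\<^sup>\<star>" using u sub by (auto simp: p clone_operator_iff)
    then have "(y + x, u1 + u2) \<in> D\<^sup>\<star>"
      using complex_vector.subspace_add[OF csubspace_op_adjoint[of D]] by force
    then have mn: "(?m, ?n) \<in> D\<^sup>\<star>"
      using complex_vector.subspace_scale[OF csubspace_op_adjoint[of D], of _ "1/2"]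
      by (force simp: scaleC_prod_def add.commute)
    have v12: "(a ?m, v1) \<in> D\<^sup>\<star>" "(a ?m, v2) \<in> D\<^sup>\<star>"
      using v sub by (auto simp: p block_eq[OF a] clone_operator_iff)
    then have "v1 = v2"
      using single_valued_op_adjoint[OF closed_operatorD(3)[OF D(1)]] by (auto dest: single_valuedD)
    moreover have "T ?m = v1 - a ?n"
      using mn v12(1) by (intro T_eq) (auto simp: commutator_def)
    ultimately show ?thesis by (simp add: p q block_eq[OF a] block_eq[OF T])
  qed
  then show ?thesis
    using T by (auto simp: bounded_extension_def bounded_clinear_averaging_block)
qed

text \<open>The commutator is defined on all of \<open>dom(D\<^sup>*)\<close>, which is dense, so its bounded extension is unique.\<close>

lemma deriv_op_eqI:
  assumes dense: "densely_defined (D\<^sup>\<star>)" and a: "a ` Domain (D\<^sup>\<star>) \<subseteq> Domain (D\<^sup>\<star>)"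
    and ext: "bounded_extension (commutator (D\<^sup>\<star>) a) T"
  shows "deriv_op D a = T"
  unfolding deriv_op_def
proof (rule the_equality[where P = "bounded_extension (commutator (D\<^sup>\<star>) a)", OF ext])
  have T_eq: "T x = y" if "(x, y) \<in> commutator (D\<^sup>\<star>) a" for x y
    using ext that by (auto simp: bounded_extension_def)
  fix T' assume ext': "bounded_extension (commutator (D\<^sup>\<star>) a) T'"
  have T'_eq: "T' x = y" if "(x, y) \<in> commutator (D\<^sup>\<star>) a" for x y
    using ext' that by (auto simp: bounded_extension_def)
  have "T' x - T x = 0" if "x \<in> closure (Domain (D\<^sup>\<star>))" for x
  proof (rule continuous_constant_on_closure[where f = "\<lambda>x. T' x - T x", OF _ _ that])
    show "continuous_on (closure (Domain (D\<^sup>\<star>))) (\<lambda>x. T' x - T x)"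
      using ext ext'
      by (intro linear_continuous_on bounded_linear_sub bounded_clinear_bounded_linear)
        (simp_all add: bounded_extension_def)
    fix x assume x: "x \<in> Domain (D\<^sup>\<star>)"
    then obtain u where u: "(x, u) \<in> D\<^sup>\<star>" by blast
    have "a x \<in> Domain (D\<^sup>\<star>)" using a x by blast
    then obtain v where "(a x, v) \<in> D\<^sup>\<star>" by blast
    then have "(x, v - a u) \<in> commutator (D\<^sup>\<star>) a" using u by (auto simp: commutator_def)
    then show "T' x - T x = 0" by (simp add: T_eq T'_eq)
  qed
  then show "T' = T" using dense by (simp add: densely_defined_def fun_eq_iff)
qed

lemma grading_tensor_mat_1:
  assumes \<gamma>: "grading \<gamma>" shows "grading (\<gamma> \<otimes>\<^sub>2 mat 1)"
proof -
  have bc: "bounded_clinear \<gamma>" and ad: "cadjoint \<gamma> = \<gamma>" and inv: "\<gamma> \<circ> \<gamma> = id"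
    using \<gamma> by (auto simp: grading_def)
  let ?g = "\<lambda>p. (\<gamma> (fst p), \<gamma> (snd p))"
  have "bounded_clinear ?g"
    by (intro bounded_clinear_Pair bounded_clinear_compose[OF bc] bounded_clinear_fst bounded_clinear_snd)
  moreover have "cadjoint ?g = ?g"
    using cinner_cadjoint[OF bc] by (intro cadjoint_eqI) (simp add: cinner_prod_def ad)
  moreover have "?g \<circ> ?g = id" using inv by (simp add: fun_eq_iff)
  ultimately show ?thesis by (simp add: grading_def tensor_mat_1)
qed

theorem proposition3p7:
  fixes A :: "('h::separable_complex_hilbert_space \<Rightarrow> 'h) set"
    and D :: "('h \<times> 'h) set"
  assumes "pre_spectral_triple A D"
  shows
    "selfadjoint_operator (clone_operator D) \<and>
     (\<forall>a\<in>A.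
        (a \<otimes>\<^sub>2 clone_q) ` Domain (clone_operator D) \<subseteq> Domain (clone_operator D) \<and>
        bounded_extension (commutator (clone_operator D) (a \<otimes>\<^sub>2 clone_q))
          (deriv_op D a \<otimes>\<^sub>2 clone_q)) \<and>
     spectral_triple (clone_algebra A) (clone_operator D) \<and>
     (\<forall>p>0. p_dimensional p A D \<longrightarrow>
        p_dimensional p (clone_algebra A) (clone_operator D)) \<and>
     (\<forall>\<gamma>. even_pre_spectral_triple A D \<gamma> \<longrightarrow>
        even_pre_spectral_triple (clone_algebra A) (clone_operator D) (\<gamma> \<otimes>\<^sub>2 mat 1))"
proof -
  let ?D2 = "clone_operator D"
  have A: "star_subalgebra A" and D: "closed_operator D" "symmetric_operator D"
    and triple: "\<And>a. a \<in> A \<Longrightarrow> a ` Domain (D\<^sup>\<star>) \<subseteq> Domain D"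
      "\<And>a. a \<in> A \<Longrightarrow> \<exists>T. bounded_extension (commutator (D\<^sup>\<star>) a) T"
      "\<And>a. a \<in> A \<Longrightarrow> compact_operator (a \<circ> one_plus_neg_power (abs_square D) (1/2))"
    using assms by (auto simp: pre_spectral_triple_def closed_operator_def)
  note D' = closed_operatorD[OF D(1)]
  have sub: "D \<subseteq> D\<^sup>\<star>" using D(2) by (simp add: symmetric_operator_def)
  have Ds: "densely_defined (D\<^sup>\<star>)" by (rule densely_defined_op_adjoint[OF D'(3) D(2)])
  have sq_adj: "abs_square_adjoint D = abs_square (D\<^sup>\<star>)"
    by (simp add: abs_square_adjoint_def abs_square_def op_adjoint_op_adjoint[OF D'(1,4)])
  have bc: "bounded_clinear a" and ad: "cadjoint a \<in> A" if "a \<in> A" for a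
    using A that by (auto simp: star_subalgebra_def)
  have ext: "bounded_extension (commutator (D\<^sup>\<star>) a) (deriv_op D a)" if a: "a \<in> A" for a
  proof -
    obtain T where T: "bounded_extension (commutator (D\<^sup>\<star>) a) T" using triple(2)[OF a] by blast
    moreover have "a ` Domain (D\<^sup>\<star>) \<subseteq> Domain (D\<^sup>\<star>)" using triple(1)[OF a] Domain_mono[OF sub] by blast
    ultimately show ?thesis using deriv_op_eqI[OF Ds] by metis
  qed
  have sa: "selfadjoint_operator ?D2" by (rule selfadjoint_clone_operator[OF D])
  then have adj: "?D2\<^sup>\<star> = ?D2" and D2: "linear_operator ?D2" "densely_defined ?D2"
    by (auto simp: selfadjoint_operator_def)
  have dom: "averaging_block a a ` Domain ?D2 \<subseteq> Domain ?D2" if a: "a \<in> A" for a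
  proof (rule image_subsetI)
    fix p assume "p \<in> Domain ?D2"
    then obtain v w where "(snd p, v) \<in> D\<^sup>\<star>" "(fst p, w) \<in> D"
      by (auto simp: clone_operator_def)
    then have "fst p \<in> Domain (D\<^sup>\<star>)" "snd p \<in> Domain (D\<^sup>\<star>)" using sub by blast+
    then obtain x y where "(a (fst p), x) \<in> D" "(a (snd p), y) \<in> D" using triple(1)[OF a] by blast
    then have "(a (fst p) + a (snd p), x + y) \<in> D"
      using complex_vector.subspace_add[OF D'(1)] by fastforce
    then have "((1/2) *\<^sub>C (a (fst p) + a (snd p)), (1/2) *\<^sub>C (x + y)) \<in> D"
      using complex_vector.subspace_scale[OF D'(1), of _ "1/2"] by (fastforce simp: scaleC_prod_def)
    then show "averaging_block a a p \<in> Domain ?D2"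
      using sub unfolding averaging_block_def clone_operator_def by blast
  qed
  have ext2: "bounded_extension (commutator ?D2 (averaging_block a a))
      (averaging_block (deriv_op D a) (deriv_op D a))" if a: "a \<in> A" for a
    by (rule bounded_extension_clone_commutator[OF D bc[OF a] ext[OF a]])
  have deriv2: "deriv_op ?D2 (averaging_block a a) = averaging_block (deriv_op D a) (deriv_op D a)"
    if a: "a \<in> A" for a
    using D2 dom[OF a] ext2[OF a] by (intro deriv_op_eqI) (simp_all add: adj)
  have cpt: "compact_operator (averaging_block a a \<circ> one_plus_neg_power (abs_square ?D2) (1/2))"
    if a: "a \<in> A" for a
  proof -
    have "compact_operator (a \<circ> one_plus_neg_power (abs_square (D\<^sup>\<star>)) (1/2))"
      using compact_operator_inverse_sqrt_adjoint[OF D bc[OF a] triple(1)[OF a] ext[OF a] bc[OF ad[OF a]]]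
        triple(3)[OF ad[OF a]] by (simp add: abs_square_def)
    then show ?thesis
      using compact_operator_averaging_block[OF triple(3)[OF a]]
      by (simp add: averaging_block_comp_clone_power[OF D])
  qed
  have closed2: "closed ?D2" using closed_op_adjoint[of ?D2] by (simp add: adj)
  have ext2_ex: "\<exists>T. bounded_extension (commutator ?D2 (averaging_block a a)) T" if "a \<in> A" for a
    using ext2[OF that] by blast
  have pre2: "pre_spectral_triple (clone_algebra A) ?D2"
    unfolding pre_spectral_triple_def
    using star_subalgebra_clone_algebra[OF A] D2 closed2 dom ext2_ex cpt
    by (auto simp: clone_algebra_eq adj symmetric_operator_def)
  have pdim: "p_dimensional p (clone_algebra A) ?D2" if p: "p > 0" "p_dimensional p A D" for p
  proof -
    have block: "averaging_block T T \<circ> one_plus_neg_power (abs_square ?D2) (p/2) \<in> \<L>\<^sub>1\<^sub>\<infinity>"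
      if "T \<circ> one_plus_neg_power (abs_square D) (p/2) \<in> \<L>\<^sub>1\<^sub>\<infinity>"
        "T \<circ> one_plus_neg_power (abs_square_adjoint D) (p/2) \<in> \<L>\<^sub>1\<^sub>\<infinity>" for T
      using weak_trace_ideal_averaging_block[OF that] p(1)
      by (simp add: averaging_block_comp_clone_power[OF D] sq_adj)
    have "abs_square_adjoint ?D2 = abs_square ?D2"
      by (simp add: abs_square_adjoint_def abs_square_def adj)
    then show ?thesis
      using p(2) pre2 block by (auto simp: p_dimensional_def clone_algebra_eq deriv2)
  qed
  have even: "even_pre_spectral_triple (clone_algebra A) ?D2 (\<gamma> \<otimes>\<^sub>2 mat 1)"
    if \<gamma>: "even_pre_spectral_triple A D \<gamma>" for \<gamma>
  proof -
    have gr: "grading \<gamma>" and comm: "\<And>a. a \<in> A \<Longrightarrow> \<gamma> \<circ> a = a \<circ> \<gamma>"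
      and anti: "\<And>x y. (x, y) \<in> D \<Longrightarrow> (\<gamma> x, - \<gamma> y) \<in> D"
      using \<gamma> by (auto simp: even_pre_spectral_triple_def)
    have g: "bounded_clinear \<gamma>" "cadjoint \<gamma> = \<gamma>" using gr by (auto simp: grading_def)
    \<comment> \<open>Anticommutation with \<open>D\<close> passes to \<open>D\<^sup>*\<close> because \<open>\<gamma>\<close> is self-adjoint.\<close>
    have anti_adj: "(\<gamma> y, - \<gamma> v) \<in> D\<^sup>\<star>" if "(y, v) \<in> D\<^sup>\<star>" for y v
      unfolding op_adjoint_iff
    proof (intro allI impI)
      fix x w assume "(x, w) \<in> D"
      then have "cinner y (- \<gamma> w) = cinner v (\<gamma> x)"
        using op_adjoint_cinner[OF that anti] by simp
      then show "cinner (\<gamma> y) w = cinner (- \<gamma> v) x"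
        using cinner_cadjoint[OF g(1)] by (simp add: g(2) cinner.minus_left cinner.minus_right minus_equation_iff)
    qed
    have "(\<gamma> \<otimes>\<^sub>2 mat 1) \<circ> averaging_block a a = averaging_block a a \<circ> (\<gamma> \<otimes>\<^sub>2 mat 1)"
      if a: "a \<in> A" for a
      using comm[OF a] linear_simps(1)[OF bounded_clinear_bounded_linear[OF g(1)]]
      by (simp add: tensor_mat_1 averaging_block_def fun_eq_iff bounded_clinear_scaleC[OF g(1)])
    moreover have "((\<gamma> \<otimes>\<^sub>2 mat 1) p, - (\<gamma> \<otimes>\<^sub>2 mat 1) q) \<in> ?D2" if "(p, q) \<in> ?D2" for p q
      using that anti anti_adj by (auto simp: clone_operator_def tensor_mat_1)
    ultimately show ?thesis
      using pre2 grading_tensor_mat_1[OF gr]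
      by (auto simp: even_pre_spectral_triple_def clone_algebra_eq)
  qed
  show ?thesis
    using sa dom ext2 pre2 pdim even by (auto simp: tensor_clone_q spectral_triple_def adj)
qed

end
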